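(* Let $0<q<1$ and let $g$ be a function on $[-1,1]$ that is continuous except for finitely many jumps. Then, with $\mathcal{D}_p$ ($q<p<1$) the Askey-Wilson operator defined by the divided difference formula given in the context, applied to the analytic extension of $\mathcal{D}_q^{-1}g$, the limiting relation $$\lim_{p\to q^+}(\mathcal{D}_p\mathcal{D}_q^{-1}g)(x)=g(x)$$ holds at the points of continuity $x$ of $g$.
   Context: Definition of $\mathcal{D}_q^{-1}$: for a nome $s$ with $|s|<1$ let $\vartheta_4(z,s)=\sum_{n=-\infty}^{\infty}(-1)^ns^{n^2}e^{2inz}$, and let $\vartheta_4'$ denote its derivative with respect to $z$. For $g$ on $[-1,1]$ with $\int_{-1}^1|g(x)|^2(1-x^2)^{1/2}dx<\infty$, $$(\mathcal{D}_q^{-1}g)(\cos\theta)=\frac{1-q}{4\pi\sqrt q}\int_{-\pi}^{\pi}\frac{\vartheta_4'((\theta+\phi)/2,\sqrt q)}{\vartheta_4((\theta+\phi)/2,\sqrt q)}\,g(\cos\phi)\,\sin\phi\,d\phi .$$ This formula makes sense for all complex $\theta$ with $|\mathrm{Im}\,\theta|<\frac12\log(1/q)$, i.e. $q^{1/2}<|e^{i\theta}|<q^{-1/2}$. Its right side is even and $2\pi$-periodic in $\theta$, so it defines an analytic extension of $\mathcal{D}_q^{-1}g$ to the interior of the ellipse $|z+\sqrt{z^2-1}|=q^{-1/2}$ (with foci $\pm1$) in the complex $z$-plane, where the branch is such that $\sqrt{z^2-1}\approx z$ as $z\to\infty$. Definition of $\mathcal{D}_p$ (divided difference form): for a function $f$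 of $x=\cos\theta$ put $\breve f(e^{i\theta}):=f(\cos\theta)$ (for complex $\theta$ in the domain where $f$ is extended). Then for $x=\cos\theta\in[-1,1]$, $$(\mathcal{D}_pf)(x)=\frac{\breve f(p^{1/2}e^{i\theta})-\breve f(p^{-1/2}e^{i\theta})}{i(p^{1/2}-p^{-1/2})\sin\theta}.$$ At $x=\pm1$, where $\sin\theta=0$, the value is understood as the limit (removable singularity). For $f=\mathcal{D}_q^{-1}g$ and $q<p<1$ the points $p^{\pm1/2}e^{i\theta}$ ($\theta$ real) lie in $q^{1/2}<|z|<q^{-1/2}$, so $\mathcal{D}_pf$ is well defined. A jump is a point of discontinuity at which the finite one-sided limits exist. *)

theory Defs
  imports "HOL-Complex_Analysis.Complex_Analysis"
begin

definition theta4 :: "complex \<Rightarrow> complex \<Rightarrow> complex" where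
  "theta4 z s = (\<Sum>\<^sub>\<infinity>n\<in>(UNIV::int set). (-1) powi n * s powi (n\<^sup>2) * exp (2 * \<i> * of_int n * z))"

definition theta4' :: "complex \<Rightarrow> complex \<Rightarrow> complex" where
  "theta4' z s = deriv (\<lambda>w. theta4 w s) z"

definition AW_inv_trig :: "real \<Rightarrow> (real \<Rightarrow> complex) \<Rightarrow> complex \<Rightarrow> complex" where
  "AW_inv_trig q g \<theta> =
     of_real ((1 - q) / (4 * pi * sqrt q)) *
     integral {-pi..pi} (\<lambda>\<phi>.
       theta4' ((\<theta> + of_real \<phi>) / 2) (of_real (sqrt q)) /
       theta4 ((\<theta> + of_real \<phi>) / 2) (of_real (sqrt q)) *
       g (cos \<phi>) * of_real (sin \<phi>))"

text \<open>
  The inverse Askey-Wilson operator as a function of \<open>z = cos \<theta>\<close>, including its analytic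
  extension to the interior of the ellipse \<open>\<bar>z + sqrt (z\<^sup>2 - 1)\<bar> = q powr (-1/2)\<close> (outside of it
  the values are irrelevant). The choice of \<open>\<theta>\<close> with \<open>cos \<theta> = z\<close> is immaterial, see
  \<open>AW_inv_cos\<close> below.
\<close>
definition AW_inv :: "real \<Rightarrow> (real \<Rightarrow> complex) \<Rightarrow> complex \<Rightarrow> complex" where
  "AW_inv q g z = AW_inv_trig q g (Arccos z)"

text \<open>\<open>breve f (exp (\<i> * \<theta>)) = f (cos \<theta>)\<close>, see \<open>breve_exp\<close> below.\<close>
definition breve :: "(complex \<Rightarrow> complex) \<Rightarrow> complex \<Rightarrow> complex" where
  "breve f w = f ((w + inverse w) / 2)"

definition AW_quotient :: "real \<Rightarrow> (complex \<Rightarrow> complex) \<Rightarrow> real \<Rightarrow> complex" where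
  "AW_quotient p f \<theta> =
     (breve f (of_real (p powr (1/2)) * exp (\<i> * of_real \<theta>)) -
      breve f (of_real (p powr (-1/2)) * exp (\<i> * of_real \<theta>))) /
     (\<i> * of_real (p powr (1/2) - p powr (-1/2)) * of_real (sin \<theta>))"

text \<open>At \<open>x = 1\<close> and \<open>x = -1\<close> the value is the limit of the quotient (removable singularity).\<close>
definition AW_op :: "real \<Rightarrow> (complex \<Rightarrow> complex) \<Rightarrow> real \<Rightarrow> complex" where
  "AW_op p f x =
     (if sin (arccos x) \<noteq> 0 then AW_quotient p f (arccos x)
      else Lim (at (arccos x)) (AW_quotient p f))"

text \<open>
  Functions on \<open>[-1, 1]\<close> are represented by functions on the reals whose values outside
  \<open>[-1, 1]\<close> do not matter. At an endpoint only the one-sided limit from inside is required: the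
  other filter is trivial, as the set in it is empty.
\<close>
definition is_jump :: "(real \<Rightarrow> complex) \<Rightarrow> real \<Rightarrow> bool" where
  "is_jump g x \<longleftrightarrow>
     \<not> continuous (at x within {-1..1}) g \<and>
     (\<exists>l. (g \<longlongrightarrow> l) (at x within {-1..<x})) \<and>
     (\<exists>r. (g \<longlongrightarrow> r) (at x within {x<..1}))"

definition continuous_except_jumps :: "(real \<Rightarrow> complex) \<Rightarrow> bool" where
  "continuous_except_jumps g \<longleftrightarrow>
     finite {x\<in>{-1..1}. \<not> continuous (at x within {-1..1}) g} \<and>
     (\<forall>x\<in>{-1..1}. \<not> continuous (at x within {-1..1}) g \<longrightarrow> is_jump g x)"

lemma breve_exp: "breve f (exp (\<i> * \<theta>)) = f (cos \<theta>)"
  by (simp add: breve_def cos_exp_eq exp_minus)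

lemma summable_gaussian_int:
  fixes t R :: real
  assumes "0 \<le> t" "t < 1"
  shows "(\<lambda>n::int. (t ^ nat \<bar>n\<bar> * R) ^ nat \<bar>n\<bar>) summable_on UNIV"
proof -
  let ?f = "\<lambda>k::nat. (t ^ k * R) ^ k"
  have "(\<lambda>k. t ^ k * R) \<longlonglongrightarrow> 0 * R"
    using assms by (intro tendsto_intros LIMSEQ_power_zero) auto
  hence "eventually (\<lambda>k. dist (t ^ k * R) 0 < 1/2) sequentially"
    by (intro tendstoD) auto
  hence "eventually (\<lambda>k. norm (norm (?f k)) \<le> (1/2) ^ k) sequentially"
  proof eventually_elim
    case (elim k)
    hence "norm (t ^ k * R) ^ k \<le> (1/2) ^ k"
      by (intro power_mono) auto
    thus ?case by (simp only: real_norm_def abs_abs power_abs)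
  qed
  hence "summable (\<lambda>k. norm (?f k))"
    by (rule summable_comparison_test_ev) (simp add: summable_geometric)
  hence *: "?f summable_on UNIV"
    by (rule norm_summable_imp_summable_on)
  have 1: "(\<lambda>n::int. ?f (nat \<bar>n\<bar>)) summable_on range int"
    using * by (subst summable_on_reindex) (auto simp: o_def)
  have 2: "(\<lambda>n::int. ?f (nat \<bar>n\<bar>)) summable_on range (\<lambda>k. - int k)"
    using * by (subst summable_on_reindex) (auto simp: o_def inj_def)
  have "(\<lambda>n::int. ?f (nat \<bar>n\<bar>)) summable_on (range int \<union> (range (\<lambda>k. - int k) - range int))"
    by (intro summable_on_Un_disjoint 1 summable_on_subset_banach[OF 2]) auto
  moreover have "range int \<union> (range (\<lambda>k. - int k) - range int) = UNIV"
  proof -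
    have "n \<in> range int \<or> n \<in> range (\<lambda>k. - int k)" for n :: int
      by (cases n rule: int_cases2) auto
    thus ?thesis by auto
  qed
  ultimately show ?thesis by simp
qed

lemma theta4_holomorphic:
  assumes "norm s < 1"
  shows "(\<lambda>z. theta4 z s) holomorphic_on UNIV"
proof -
  have "(\<lambda>z. theta4 z s) holomorphic_on ball 0 r" if "r > 0" for r
  proof -
    define R where "R = exp (2 * r)"
    let ?g = "\<lambda>n z. (-1) powi n * s powi (n\<^sup>2) * exp (2 * \<i> * of_int n * z)"
    have bound: "norm (?g n z) \<le> (norm s ^ nat \<bar>n\<bar> * R) ^ nat \<bar>n\<bar>" if "z \<in> cball 0 r" for n z
    proof -
      have [simp]: "norm ((-1::complex) powi n) = 1"
        by (simp add: norm_power_int)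
      have "n\<^sup>2 = int (nat \<bar>n\<bar> * nat \<bar>n\<bar>)"
        by (simp add: power2_eq_square)
      hence A: "norm (s powi (n\<^sup>2)) = (norm s ^ nat \<bar>n\<bar>) ^ nat \<bar>n\<bar>"
        by (simp only: power_int_of_nat norm_power power_mult)
      have "\<bar>Im z\<bar> \<le> r"
        using that abs_Im_le_cmod[of z] by simp
      hence "\<bar>real_of_int n\<bar> * \<bar>Im z\<bar> \<le> \<bar>real_of_int n\<bar> * r"
        by (intro mult_left_mono) auto
      hence "\<bar>real_of_int n * Im z\<bar> \<le> \<bar>real_of_int n\<bar> * r"
        by (simp add: abs_mult)
      hence "- (real_of_int n * Im z) \<le> \<bar>real_of_int n\<bar> * r"
        by linarith
      hence "norm (exp (2 * \<i> * of_int n * z)) \<le> exp (real (nat \<bar>n\<bar>) * (2 * r))"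
        by (simp add: norm_exp_eq_Re mult.commute)
      also have "\<dots> = R ^ nat \<bar>n\<bar>"
        unfolding R_def by (rule exp_of_nat_mult)
      finally have B: "norm (exp (2 * \<i> * of_int n * z)) \<le> R ^ nat \<bar>n\<bar>" .
      have "norm (?g n z) = (norm s ^ nat \<bar>n\<bar>) ^ nat \<bar>n\<bar> * norm (exp (2 * \<i> * of_int n * z))"
        by (simp only: norm_mult A) simp
      also have "\<dots> \<le> (norm s ^ nat \<bar>n\<bar>) ^ nat \<bar>n\<bar> * R ^ nat \<bar>n\<bar>"
        by (intro mult_left_mono B) auto
      finally show ?thesis by (simp only: power_mult_distrib)
    qed
    have U: "uniform_limit (cball 0 r) (\<lambda>X z. \<Sum>n\<in>X. ?g n z) (\<lambda>z. \<Sum>\<^sub>\<infinity>n\<in>UNIV. ?g n z)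
            (finite_subsets_at_top UNIV)"
      by (rule Weierstrass_m_test_general[OF bound summable_gaussian_int]) (use assms in auto)
    show ?thesis
      unfolding theta4_def
      by (rule holomorphic_uniform_limit[OF _ U])
         (auto intro!: always_eventually holomorphic_intros continuous_intros)
  qed
  hence "(\<lambda>z. theta4 z s) field_differentiable at z" for z
    by (meson holomorphic_on_imp_differentiable_at[OF _ open_ball, of _ 0 "norm z + 1" z]
          add_nonneg_pos norm_ge_zero zero_less_one mem_ball_0 less_add_one)
  thus ?thesis
    by (simp add: holomorphic_on_def field_differentiable_at_within)
qed

lemma theta4_minus: "theta4 (-z) s = theta4 z s"
  unfolding theta4_def
  by (rule infsum_reindex_bij_witness[of _ uminus uminus])
     (auto simp: power_int_minus_one_minus)

lemma theta4_plus_pi: "theta4 (z + of_int k * of_real pi) s = theta4 z s"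
proof -
  have "exp (2 * \<i> * of_int n * (z + of_int k * of_real pi)) = exp (2 * \<i> * of_int n * z)" for n
  proof -
    have "2 * \<i> * of_int n * (z + of_int k * of_real pi) =
            2 * \<i> * of_int n * z + \<i> * (of_int (n * k) * (of_real pi * 2))"
      by (simp add: algebra_simps)
    thus ?thesis by (simp only: exp_plus_2pin)
  qed
  thus ?thesis by (simp add: theta4_def)
qed

lemma theta4'_minus:
  assumes "norm s < 1"
  shows "theta4' (-z) s = - theta4' z s"
proof -
  have *: "((\<lambda>w. theta4 w s) has_field_derivative theta4' w s) (at w)" for w
    using theta4_holomorphic[OF assms] unfolding theta4'_def
    by (intro holomorphic_derivI[of _ UNIV]) auto
  have "((\<lambda>w. theta4 (-w) s) has_field_derivative theta4' (-z) s * (-1)) (at z)"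
    by (rule DERIV_chain2[OF *]) (auto intro!: derivative_eq_intros)
  hence "((\<lambda>w. theta4 w s) has_field_derivative - theta4' (-z) s) (at z)"
    by (simp add: theta4_minus)
  from DERIV_unique[OF this *[of z]] show ?thesis
    by (metis minus_minus)
qed

lemma theta4'_plus_pi: "theta4' (z + of_int k * of_real pi) s = theta4' z s"
proof -
  have "theta4' (z + of_int k * of_real pi) s =
          deriv ((\<lambda>w. theta4 w s) \<circ> (\<lambda>x. (z + of_int k * of_real pi) + x)) 0"
    unfolding theta4'_def by (rule deriv_shift_0)
  also have "(\<lambda>w. theta4 w s) \<circ> (\<lambda>x. (z + of_int k * of_real pi) + x) =
             (\<lambda>w. theta4 w s) \<circ> (\<lambda>x. z + x)"
    using theta4_plus_pi[of "z + _" k s] by (simp add: fun_eq_iff add_ac)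
  also have "deriv \<dots> 0 = theta4' z s"
    unfolding theta4'_def by (rule deriv_shift_0 [symmetric])
  finally show ?thesis .
qed

lemma AW_inv_trig_minus:
  assumes "0 < q" "q < 1"
  shows "AW_inv_trig q g (-\<theta>) = AW_inv_trig q g \<theta>"
proof -
  define s where "s = complex_of_real (sqrt q)"
  have s: "norm s < 1" using assms by (simp add: s_def)
  let ?h = "\<lambda>\<theta> \<phi>. theta4' ((\<theta> + of_real \<phi>) / 2) s / theta4 ((\<theta> + of_real \<phi>) / 2) s *
                g (cos \<phi>) * of_real (sin \<phi>)"
  have "?h (-\<theta>) (-\<phi>) = ?h \<theta> \<phi>" for \<phi>
  proof -
    have "(-\<theta> + of_real (-\<phi>)) / 2 = - ((\<theta> + of_real \<phi>) / 2)"
      by (simp add: field_simps)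
    thus ?thesis
      by (simp only: theta4_minus theta4'_minus[OF s]) simp
  qed
  hence "integral {-pi..pi} (?h \<theta>) = integral {-pi..-(-pi)} (\<lambda>\<phi>. ?h (-\<theta>) (-\<phi>))"
    by simp
  also have "\<dots> = integral {-pi..pi} (?h (-\<theta>))"
    by (rule Henstock_Kurzweil_Integration.integral_reflect_real[where f = "?h (-\<theta>)"])
  finally show ?thesis
    by (simp add: AW_inv_trig_def s_def)
qed

lemma AW_inv_trig_plus_2pi: "AW_inv_trig q g (\<theta> + of_int k * (2 * of_real pi)) = AW_inv_trig q g \<theta>"
proof -
  have "(\<theta> + of_int k * (2 * of_real pi) + of_real \<phi>) / 2 =
        (\<theta> + of_real \<phi>) / 2 + of_int k * of_real pi" for \<phi>
    by (simp add: field_simps)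
  thus ?thesis
    by (simp only: AW_inv_trig_def theta4_plus_pi theta4'_plus_pi)
qed

lemma AW_inv_cos:
  assumes "0 < q" "q < 1"
  shows "AW_inv q g (cos \<theta>) = AW_inv_trig q g \<theta>"
proof -
  have "cos (Arccos (cos \<theta>)) = cos \<theta>" by simp
  then obtain n where n: "n \<in> \<int>"
    "Arccos (cos \<theta>) = \<theta> + of_real (2 * n * pi) \<or> Arccos (cos \<theta>) = - \<theta> + of_real (2 * n * pi)"
    by (subst (asm) complex_cos_eq) blast
  then obtain k where "n = of_int k" by (elim Ints_cases)
  hence "of_real (2 * n * pi) = of_int k * (2 * complex_of_real pi)" by simp
  with n(2) show ?thesis
    unfolding AW_inv_def using AW_inv_trig_plus_2pi AW_inv_trig_minus[OF assms] by metis
qed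

lemma AW_quotient_minus: "AW_quotient p f (-\<theta>) = AW_quotient p f \<theta>"
proof (cases "p = 0")
  case False
  have *: "breve f (inverse w) = breve f w" for w
    by (simp add: breve_def add_ac)
  have "inverse (of_real (p powr a) * exp (\<i> * of_real \<theta>)) =
        of_real (p powr (-a)) * exp (\<i> * of_real (-\<theta>))" for a
    by (simp add: exp_minus powr_minus)
  from this[of "1/2"] this[of "-1/2"]
  have "breve f (of_real (p powr (1/2)) * exp (\<i> * of_real (-\<theta>))) =
        breve f (of_real (p powr (-1/2)) * exp (\<i> * of_real \<theta>))"
       "breve f (of_real (p powr (-1/2)) * exp (\<i> * of_real (-\<theta>))) =
        breve f (of_real (p powr (1/2)) * exp (\<i> * of_real \<theta>))"
    by (metis * minus_divide_left minus_minus)+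
  moreover have "(b - a) / (c * of_real (- d)) = (a - b) / (c * of_real d)" for a b c :: complex and d
    by (cases "c * of_real d = 0") (auto simp: field_simps)
  ultimately show ?thesis
    unfolding AW_quotient_def by (simp only: sin_minus)
qed (simp add: AW_quotient_def)

lemma AW_op_cos:
  assumes "sin \<theta> \<noteq> 0"
  shows "AW_op p f (cos \<theta>) = AW_quotient p f \<theta>"
proof -
  have "cos (arccos (cos \<theta>)) = cos \<theta>" by (simp add: cos_arccos_abs)
  then obtain n where n: "n \<in> \<int>"
    "arccos (cos \<theta>) = \<theta> + 2 * n * pi \<or> arccos (cos \<theta>) = - \<theta> + 2 * n * pi"
    by (subst (asm) cos_eq) blast
  then obtain k where k: "n = of_int k" by (elim Ints_cases)
  have per: "AW_quotient p f (\<alpha> + 2 * n * pi) = AW_quotient p f \<alpha>" for \<alpha>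
  proof -
    have "exp (\<i> * of_real (\<alpha> + 2 * n * pi)) = exp (\<i> * of_real \<alpha>)"
      using exp_plus_2pin[of "\<i> * of_real \<alpha>" k] by (simp add: k algebra_simps)
    moreover have "sin (\<alpha> + 2 * n * pi) = sin \<alpha>"
      using sin.plus_of_int[of \<alpha> k] by (simp add: k mult_ac)
    ultimately show ?thesis by (simp only: AW_quotient_def)
  qed
  have "sin (arccos (cos \<theta>)) \<noteq> 0"
    using assms by (simp add: sin_arccos_abs flip: sin_squared_eq)
  thus ?thesis
    unfolding AW_op_def using n(2) per AW_quotient_minus by metis
qed

end

(* With s = sqrt q, the logarithmic derivative of theta4 has the Fourier series
   sum over n of h_n exp (2 i n z), h_n = -2 i / (s^(-n) - s^n), in the strip |Im z| < - ln s / 2.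
   Multiplying this series by the one of theta4, the claim theta4' = H theta4 becomes
   sum over n <> 0 of (-1)^n s^(n^2 - 2 m n) / (s^(-n) - s^n) = - m for all integers m,
   which telescopes in m.

   Hence D_p D_q^(-1) g (cos theta) is, up to a factor tending to 1, the integral of
   g (cos phi) sin phi / pi against sum over n of rho_n U_(n-1) (cos theta) sin (n phi), where
   rho_n = (p^(-n/2) - p^(n/2)) / (q^(-n/2) - q^(n/2)). With r = sqrt (q / p), rho_n differs
   from r^n by O(n (p - q) p^(n-1)), and replacing rho_n by r^n turns the kernel into the
   Poisson kernel for the Chebyshev polynomials of the second kind: it is nonnegative, has total
   mass r, and concentrates at cos phi = cos theta as r tends to 1. Using U_(n-1) instead of
   sin (n theta) / sin theta treats the endpoints x = 1 and x = -1 on the same footing. *)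
theory Submission
  imports Defs
begin

text \<open>The identity theta4' = H theta4 determines the quotient only where theta4 has no zero.
  No product formula is used for this: integrating the series H termwise gives a primitive P, and
  theta4 exp (-P) is constant on the strip, so a zero would force theta4 to vanish at pi / 2 as
  well, where its series has positive terms. The points p^(1/2) e^(i theta) and p^(-1/2) e^(i theta)
  lead to arguments z with |Im z| = - ln p / 4, inside the strip exactly when p > q. As p tends to q
  they reach its boundary and rho_n tends to 1 for n >= 1, so the kernel series has no limit that
  could be integrated; hence the approximate identity. Positivity is read off from a closed form,
  which is at hand for the weights r^n but not for rho_n. The replacement error is harmless because
  |U_(n-1)| <= n on [-1, 1]: it is at most a constant times p - q times the sum of n^2 b^(n-1), for
  any fixed b with p <= b < 1.\<close>

section \<open>The logarithmic derivative of theta4\<close>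

text \<open>The weights exp (2 |n| b) dominate |exp (2 i n w)| on the whole strip |Im w| < b, so
  convergence there is uniform, and a uniform limit of holomorphic functions may be differentiated
  termwise. This serves both for \<open>theta4\<close> and for the primitive of its logarithmic
  derivative.\<close>

lemma fourier_series_derivative:
  fixes c :: "int \<Rightarrow> complex"
  assumes c: "(\<lambda>n. norm (c n) * exp (2 * \<bar>real_of_int n\<bar> * b)) summable_on UNIV"
    and z: "\<bar>Im z\<bar> < b"
  defines "F \<equiv> \<lambda>w. \<Sum>\<^sub>\<infinity>n\<in>UNIV. c n * exp (2 * \<i> * of_int n * w)"
  shows "(F has_field_derivative deriv F z) (at z)"
    and "((\<lambda>n. c n * exp (2 * \<i> * of_int n * z)) has_sum F z) UNIV"
    and "((\<lambda>n. 2 * \<i> * of_int n * c n * exp (2 * \<i> * of_int n * z)) has_sum deriv F z) UNIV"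
proof -
  define S where "S = {w. \<bar>Im w\<bar> < b}"
  have "S = Im -` {-b<..<b}"
    by (auto simp: S_def)
  hence S: "open S" "z \<in> S"
    using z by (auto simp: S_def continuous_on_Im intro!: open_vimage)
  have U: "uniform_limit S (\<lambda>X w. \<Sum>n\<in>X. c n * exp (2 * \<i> * of_int n * w)) F
             (finite_subsets_at_top UNIV)"
    unfolding F_def
  proof (rule Weierstrass_m_test_general[OF _ c])
    fix n w assume "w \<in> S"
    hence "\<bar>real_of_int n\<bar> * \<bar>Im w\<bar> \<le> \<bar>real_of_int n\<bar> * b"
      by (intro mult_left_mono) (auto simp: S_def)
    hence "\<bar>real_of_int n * Im w\<bar> \<le> \<bar>real_of_int n\<bar> * b"
      by (simp add: abs_mult)
    hence "- (Im w * real_of_int n) \<le> b * \<bar>real_of_int n\<bar>"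
      by (simp add: mult.commute)
    hence "norm (exp (2 * \<i> * of_int n * w)) \<le> exp (2 * \<bar>real_of_int n\<bar> * b)"
      by (simp add: norm_exp_eq_Re)
    thus "norm (c n * exp (2 * \<i> * of_int n * w)) \<le> norm (c n) * exp (2 * \<bar>real_of_int n\<bar> * b)"
      by (simp add: norm_mult mult_left_mono)
  qed
  have hol: "\<forall>\<^sub>F X in finite_subsets_at_top UNIV.
               (\<lambda>w. \<Sum>n\<in>X. c n * exp (2 * \<i> * of_int n * w)) holomorphic_on A" for A
    by (auto intro!: always_eventually holomorphic_intros)
  obtain r where r: "r > 0" "cball z r \<subseteq> S"
    using S by (meson open_contains_cball)
  have "F holomorphic_on ball z r"
    by (rule holomorphic_uniform_limit[OF _ uniform_limit_on_subset[OF U r(2)]])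
       (auto intro!: always_eventually holomorphic_intros continuous_intros)
  thus "(F has_field_derivative deriv F z) (at z)"
    by (rule holomorphic_derivI) (use r in auto)
  show "((\<lambda>n. c n * exp (2 * \<i> * of_int n * z)) has_sum F z) UNIV"
    using tendsto_uniform_limitI[OF U S(2)] by (simp add: has_sum_def)
  have "((\<lambda>X. deriv (\<lambda>w. \<Sum>n\<in>X. c n * exp (2 * \<i> * of_int n * w)) z) \<longlongrightarrow> deriv F z)
          (finite_subsets_at_top UNIV)"
    using higher_deriv_complex_uniform_limit[OF U hol _ S, of 1] by simp
  moreover have "deriv (\<lambda>w. \<Sum>n\<in>X. c n * exp (2 * \<i> * of_int n * w)) z =
                   (\<Sum>n\<in>X. 2 * \<i> * of_int n * c n * exp (2 * \<i> * of_int n * z))" for X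
    by (rule DERIV_imp_deriv)
       (auto intro!: derivative_eq_intros sum.cong)
  ultimately show "((\<lambda>n. 2 * \<i> * of_int n * c n * exp (2 * \<i> * of_int n * z)) has_sum deriv F z) UNIV"
    by (simp add: has_sum_def)
qed

lemma summable_power_nat_abs:
  fixes r :: real
  assumes "0 \<le> r" "r < 1"
  shows "(\<lambda>n::int. r ^ nat \<bar>n\<bar>) summable_on UNIV"
proof -
  have *: "(\<lambda>k. r ^ k) summable_on UNIV"
    using assms by (intro norm_summable_imp_summable_on) (simp add: power_abs)
  have 1: "(\<lambda>n::int. r ^ nat \<bar>n\<bar>) summable_on range int"
    using * by (subst summable_on_reindex) (auto simp: o_def)
  have 2: "(\<lambda>n::int. r ^ nat \<bar>n\<bar>) summable_on range (\<lambda>k. - int k)"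
    using * by (subst summable_on_reindex) (auto simp: o_def inj_def)
  have "(\<lambda>n::int. r ^ nat \<bar>n\<bar>) summable_on (range int \<union> (range (\<lambda>k. - int k) - range int))"
    by (intro summable_on_Un_disjoint 1 summable_on_subset_banach[OF 2]) auto
  moreover have "n \<in> range int \<or> n \<in> range (\<lambda>k. - int k)" for n :: int
    by (cases n rule: int_cases2) auto
  hence "range int \<union> (range (\<lambda>k. - int k) - range int) = UNIV"
    by auto
  ultimately show ?thesis by simp
qed

text \<open>The linear term is absorbed into the free constant of
  \<open>summable_gaussian_int\<close>: with R = s^(-|j|) the exponent there becomes |n| (|n| -
  |j|), which is at most n^2 + j n.\<close>

lemma summable_gaussian_powi:
  fixes s :: real
  assumes "0 < s" "s < 1"
  shows "(\<lambda>n::int. s powi (n\<^sup>2 + j * n)) summable_on UNIV"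
proof (rule summable_on_comparison_test[OF summable_gaussian_int[of s "s powi (-\<bar>j\<bar>)"]])
  fix n :: int
  have "(s ^ nat \<bar>n\<bar> * s powi (- \<bar>j\<bar>)) ^ nat \<bar>n\<bar> = (s powi \<bar>n\<bar> * s powi (- \<bar>j\<bar>)) powi \<bar>n\<bar>"
    by (simp add: power_int_def)
  also have "\<dots> = s powi ((\<bar>n\<bar> - \<bar>j\<bar>) * \<bar>n\<bar>)"
    using assms by (simp add: power_int_mult power_int_add[symmetric])
  finally have *: "(s ^ nat \<bar>n\<bar> * s powi (- \<bar>j\<bar>)) ^ nat \<bar>n\<bar> = s powi ((\<bar>n\<bar> - \<bar>j\<bar>) * \<bar>n\<bar>)" .
  have "(\<bar>n\<bar> - \<bar>j\<bar>) * \<bar>n\<bar> = n\<^sup>2 - \<bar>j * n\<bar>"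
    by (simp add: algebra_simps power2_eq_square abs_mult flip: power2_eq_square)
  hence "(\<bar>n\<bar> - \<bar>j\<bar>) * \<bar>n\<bar> \<le> n\<^sup>2 + j * n"
    by linarith
  thus "s powi (n\<^sup>2 + j * n) \<le> (s ^ nat \<bar>n\<bar> * s powi (- \<bar>j\<bar>)) ^ nat \<bar>n\<bar>"
    unfolding * using assms by (intro power_int_decreasing) auto
qed (use assms in auto)

text \<open>For k = |n| > 0, s^(-k) - s^k = s^(-k) (1 - s^(2k)) and s^(2k) <= s^2. Taking
  reciprocals gives the geometric decay of the coefficients.\<close>

lemma powi_diff_lower_bound:
  fixes s :: real
  assumes "0 < s" "s < 1" "n \<noteq> 0"
  shows "(1 - s\<^sup>2) / s ^ nat \<bar>n\<bar> \<le> \<bar>s powi (-n) - s powi n\<bar>"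
proof -
  have *: "(1 - s\<^sup>2) / s ^ k \<le> s powi (-int k) - s powi (int k)" if "k > 0" for k
  proof -
    have "s ^ (k * 2) \<le> s\<^sup>2"
      using assms that power_decreasing[of 2 "k * 2" s] by simp
    hence "(1 - s\<^sup>2) \<le> 1 - s ^ k * s ^ k"
      by (simp add: power_mult power2_eq_square)
    thus ?thesis
      using assms by (simp add: power_int_minus field_simps)
  qed
  show ?thesis
  proof (cases "n > 0")
    case True
    thus ?thesis using *[of "nat n"] by simp
  next
    case False
    thus ?thesis using *[of "nat (-n)"] assms(3) by (simp add: abs_minus_commute)
  qed
qed

lemma powi_uminus_neq:
  fixes s :: real
  assumes "0 < s" "s < 1" "n \<noteq> 0"
  shows "s powi (-n) \<noteq> s powi n"
proof -
  have "0 < (1 - s\<^sup>2) / s ^ nat \<bar>n\<bar>"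
    using assms by (simp add: power_less_one_iff)
  with powi_diff_lower_bound[OF assms] show ?thesis by linarith
qed

text \<open>At n = 0 the estimate holds through 1 / 0 = 0, so no later sum over the integers has to
  leave out n = 0.\<close>

lemma powi_diff_inverse_bound:
  fixes s :: real
  assumes "0 < s" "s < 1"
  shows "\<bar>1 / (s powi (-n) - s powi n)\<bar> \<le> s ^ nat \<bar>n\<bar> / (1 - s\<^sup>2)"
proof (cases "n = 0")
  case False
  have "0 < (1 - s\<^sup>2) / s ^ nat \<bar>n\<bar>"
    using assms by (simp add: power_less_one_iff)
  from le_imp_inverse_le[OF powi_diff_lower_bound[OF assms False] this] show ?thesis
    by (simp add: divide_simps)
qed (use assms in \<open>simp add: power_le_one\<close>)

text \<open>The reflection of n to 2 m + 1 - n keeps the exponent n (n - (2 m + 1)) and flips the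
  sign, because 2 m + 1 is odd. The sum therefore equals its own negative.\<close>

lemma alternating_gaussian_sum:
  fixes s :: real
  assumes "0 < s" "s < 1"
  shows "((\<lambda>n::int. (-1) powi n * s powi (n\<^sup>2 - (2 * m + 1) * n)) has_sum 0) UNIV"
proof -
  let ?f = "\<lambda>n::int. (-1) powi n * s powi (n\<^sup>2 - (2 * m + 1) * n)"
  have "?f summable_on UNIV"
  proof (rule summable_on_iff_abs_summable_on_real[THEN iffD2])
    show "(\<lambda>n. norm (?f n)) summable_on UNIV"
      using summable_gaussian_powi[OF assms, of "-(2 * m + 1)"] assms
      by (simp add: abs_mult power_int_abs algebra_simps)
  qed
  then obtain S where S: "(?f has_sum S) UNIV"
    by (auto simp: summable_on_def)
  have "(?f has_sum S) UNIV \<longleftrightarrow> ((\<lambda>n. - ?f n) has_sum S) UNIV"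
  proof (rule has_sum_reindex_bij_witness[of _ "\<lambda>n. 2 * m + 1 - n" "\<lambda>n. 2 * m + 1 - n"])
    fix n :: int
    have "(2 * m + 1 - n)\<^sup>2 - (2 * m + 1) * (2 * m + 1 - n) = n\<^sup>2 - (2 * m + 1) * n"
      by (simp add: algebra_simps power2_eq_square)
    moreover have "(-1) powi (2 * m + 1 - n) = - ((-1) powi n :: real)"
      by (auto simp: power_int_minus_left)
    ultimately show "- ?f (2 * m + 1 - n) = ?f n" by simp
  qed auto
  with S have "(?f has_sum (- S)) UNIV"
    by (simp add: has_sum_uminus)
  with S have "S = - S" by (rule has_sum_unique)
  with S show ?thesis by simp
qed

text \<open>Passing from m to m + 1 cancels the denominator, since s^(-2(m+1)n) - s^(-2mn) =
  s^(-(2m+1)n) (s^(-n) - s^n). The increment is thus an alternating Gaussian sum, which vanishes,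
  without its term 1 at n = 0.\<close>

lemma theta4_log_derivative_coefficient:
  fixes s :: real
  assumes s: "0 < s" "s < 1"
  shows "((\<lambda>n. (-1) powi n * s powi (n\<^sup>2 - 2 * m * n) / (s powi (-n) - s powi n)) has_sum
            - of_int m) UNIV"
proof -
  define f where "f m n = (-1) powi n * s powi (n\<^sup>2 - 2 * m * n) / (s powi (-n) - s powi n)" for m n
  have summ: "f m summable_on UNIV" for m
  proof (rule summable_on_iff_abs_summable_on_real[THEN iffD2], rule summable_on_comparison_test)
    show "(\<lambda>n. s powi (n\<^sup>2 + (-2 * m) * n) * (1 / (1 - s\<^sup>2))) summable_on UNIV"
      by (intro summable_on_cmult_left summable_gaussian_powi s)
    fix n :: int
    have "s ^ nat \<bar>n\<bar> / (1 - s\<^sup>2) \<le> 1 / (1 - s\<^sup>2)"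
      using s by (intro divide_right_mono) (auto simp: power_le_one)
    hence "\<bar>1 / (s powi (-n) - s powi n)\<bar> \<le> 1 / (1 - s\<^sup>2)"
      using powi_diff_inverse_bound[OF s, of n] by linarith
    hence "s powi (n\<^sup>2 + (-2 * m) * n) * \<bar>1 / (s powi (-n) - s powi n)\<bar> \<le>
             s powi (n\<^sup>2 + (-2 * m) * n) * (1 / (1 - s\<^sup>2))"
      using s by (intro mult_left_mono) auto
    thus "norm (f m n) \<le> s powi (n\<^sup>2 + (-2 * m) * n) * (1 / (1 - s\<^sup>2))"
      using s by (simp add: f_def abs_mult power_int_abs)
  qed auto
  \<comment> \<open>At n = 0 both values of \<open>f\<close> are 0 by division by zero;
    \<open>of_bool (n = 0)\<close> removes the term 1 that the Gaussian sum has there.\<close>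
  have step: "f (m + 1) n = f m n + ((-1) powi n * s powi (n\<^sup>2 - (2 * m + 1) * n) - of_bool (n = 0))" for m n
  proof (cases "n = 0")
    case False
    have "s powi (-n) \<noteq> s powi n"
      using powi_uminus_neq[OF s False] .
    moreover have "s powi (n\<^sup>2 - 2 * (m + 1) * n) = s powi (n\<^sup>2 - (2 * m + 1) * n) * s powi (-n)"
      using s by (simp add: algebra_simps flip: power_int_add)
    moreover have "s powi (n\<^sup>2 - 2 * m * n) = s powi (n\<^sup>2 - (2 * m + 1) * n) * s powi n"
      using s by (simp add: algebra_simps flip: power_int_add)
    ultimately show ?thesis
      using False by (simp add: f_def field_simps)
  qed (simp add: f_def)
  have delta: "((\<lambda>n::int. of_bool (n = 0)) has_sum (1::real)) UNIV"
    by (rule has_sum_finite_neutralI[of "{0}"]) auto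
  have has_sum_step: "(f (m + 1) has_sum (S - 1)) UNIV" if "(f m has_sum S) UNIV" for m S
    using has_sum_add[OF that has_sum_add[OF alternating_gaussian_sum[OF s, of m] has_sum_uminusI[OF delta]]]
    by (simp add: step[abs_def])
  \<comment> \<open>At m = 0 the numerator is even in n and the denominator is odd.\<close>
  have zero: "(f 0 has_sum 0) UNIV"
  proof -
    obtain S where S: "(f 0 has_sum S) UNIV"
      using summ by (auto simp: summable_on_def)
    have "(f 0 has_sum S) UNIV \<longleftrightarrow> ((\<lambda>n. - f 0 n) has_sum S) UNIV"
    proof (rule has_sum_reindex_bij_witness[of _ uminus uminus])
      fix n :: int
      have "s powi n - s powi (-n) = - (s powi (-n) - s powi n)" by simp
      thus "- f 0 (- n) = f 0 n"
        unfolding f_def by (simp only: minus_minus power_int_minus_one_minus divide_minus_right) simp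
    qed auto
    with S have "(f 0 has_sum (- S)) UNIV"
      by (simp add: has_sum_uminus)
    with S have "S = - S" by (rule has_sum_unique)
    with S show ?thesis by simp
  qed
  have "(f m has_sum - of_int m) UNIV"
  proof (induction m rule: int_induct[of _ 0])
    case (step1 i)
    thus ?case using has_sum_step[of i "- of_int i"] by simp
  next
    case (step2 i)
    \<comment> \<open>The recurrence leads from i - 1 to i only, so for the downward step the sum at
      i - 1 is taken from summability and then identified by uniqueness.\<close>
    obtain S where S: "(f (i - 1) has_sum S) UNIV"
      using summ by (auto simp: summable_on_def)
    have "(f i has_sum (S - 1)) UNIV"
      using has_sum_step[OF S] by simp
    with step2 have "S - 1 = - of_int i"
      by (metis has_sum_unique)
    hence "S = - of_int (i - 1)" by simp
    with S show ?case by simp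
  qed (use zero in simp)
  thus ?thesis by (simp add: f_def[abs_def])
qed

lemma theta4_has_sum:
  fixes s :: real
  assumes s: "0 < s" "s < 1"
  shows "((\<lambda>n. (-1) powi n * of_real s powi (n\<^sup>2) * exp (2 * \<i> * of_int n * z)) has_sum
            theta4 z (of_real s)) UNIV" (is ?th1)
    and "((\<lambda>n. 2 * \<i> * of_int n * ((-1) powi n * of_real s powi (n\<^sup>2)) * exp (2 * \<i> * of_int n * z))
            has_sum theta4' z (of_real s)) UNIV" (is ?th2)
proof -
  \<comment> \<open>Any b > |Im z| would do, since the Gaussian decay absorbs exp (2 |n| b).\<close>
  define b where "b = \<bar>Im z\<bar> + 1"
  have "norm ((-1) powi n * complex_of_real s powi n\<^sup>2) * exp (2 * \<bar>real_of_int n\<bar> * b) =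
          (s ^ nat \<bar>n\<bar> * exp (2 * b)) ^ nat \<bar>n\<bar>" for n
  proof -
    have "n\<^sup>2 = int (nat \<bar>n\<bar> * nat \<bar>n\<bar>)"
      by (simp add: power2_eq_square)
    hence "s powi n\<^sup>2 = (s ^ nat \<bar>n\<bar>) ^ nat \<bar>n\<bar>"
      by (simp only: power_int_of_nat power_mult)
    moreover have "exp (2 * \<bar>real_of_int n\<bar> * b) = exp (2 * b) ^ nat \<bar>n\<bar>"
      by (simp add: mult_ac flip: exp_of_nat_mult)
    ultimately show ?thesis
      using s by (simp add: norm_mult norm_power_int power_mult_distrib)
  qed
  hence *: "(\<lambda>n. norm ((-1) powi n * complex_of_real s powi n\<^sup>2) * exp (2 * \<bar>real_of_int n\<bar> * b))
              summable_on UNIV"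
    using summable_gaussian_int[of s "exp (2 * b)"] s by simp
  show ?th1
    using fourier_series_derivative(2)[OF *, of z] unfolding theta4_def by (simp add: b_def)
  show ?th2
    using fourier_series_derivative(3)[OF *, of z]
    unfolding theta4'_def theta4_def by (simp add: b_def)
qed

definition theta4_dlog_coeff :: "real \<Rightarrow> int \<Rightarrow> complex" where
  "theta4_dlog_coeff s n = - 2 * \<i> / of_real (s powi (-n) - s powi n)"

text \<open>The coefficient at 0 vanishes because of the convention \<open>x / 0 = 0\<close>.\<close>
lemma theta4_dlog_coeff_0 [simp]: "theta4_dlog_coeff s 0 = 0"
  by (simp add: theta4_dlog_coeff_def)

lemma theta4_dlog_coeff_minus: "theta4_dlog_coeff s (-n) = - theta4_dlog_coeff s n"
proof -
  have "s powi n - s powi (-n) = - (s powi (-n) - s powi n)" by simp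
  thus ?thesis
    unfolding theta4_dlog_coeff_def by (simp only: minus_minus of_real_minus divide_minus_right)
qed

lemma norm_theta4_dlog_coeff_le:
  assumes "0 < s" "s < 1"
  shows "norm (theta4_dlog_coeff s n) \<le> 2 * (s ^ nat \<bar>n\<bar> / (1 - s\<^sup>2))"
proof -
  have "norm (theta4_dlog_coeff s n) = 2 * \<bar>1 / (s powi (-n) - s powi n)\<bar>"
    unfolding theta4_dlog_coeff_def norm_divide norm_mult norm_of_real by (simp add: abs_divide)
  with powi_diff_inverse_bound[OF assms, of n] show ?thesis by simp
qed

text \<open>P turns out to be a branch of log theta4 up to an additive constant. The expansion
  itself only concerns the derivative, but P is what excludes zeros in
  \<open>theta4_nonzero\<close>. The division by n = 0 is harmless because the coefficient there is
  0.\<close>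

lemma theta4_dlog_primitive:
  assumes s: "0 < s" "s < 1" and z: "\<bar>Im z\<bar> < - ln s / 2"
  defines "P \<equiv> \<lambda>w. \<Sum>\<^sub>\<infinity>n\<in>UNIV. theta4_dlog_coeff s n / (2 * \<i> * of_int n) * exp (2 * \<i> * of_int n * w)"
  shows "(P has_field_derivative deriv P z) (at z)"
    and "((\<lambda>n. theta4_dlog_coeff s n * exp (2 * \<i> * of_int n * z)) has_sum deriv P z) UNIV"
proof -
  \<comment> \<open>The midpoint between |Im z| and - ln s / 2: the strip of half-width b contains
    z, and s exp (2 b) < 1 keeps the weighted coefficients summable.\<close>
  define b where "b = (\<bar>Im z\<bar> - ln s / 2) / 2"
  have b: "\<bar>Im z\<bar> < b" "b < - ln s / 2" "0 < b"
    using z by (auto simp: b_def)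
  have "s * exp (2 * b) < s * exp (- ln s)"
    using b s by (intro mult_strict_left_mono) auto
  also have "\<dots> = 1"
    using s by (simp add: exp_minus)
  finally have r: "s * exp (2 * b) < 1" .
  have *: "(\<lambda>n. norm (theta4_dlog_coeff s n / (2 * \<i> * of_int n)) * exp (2 * \<bar>real_of_int n\<bar> * b))
          summable_on UNIV"
  proof (rule summable_on_comparison_test)
    show "(\<lambda>n::int. (s * exp (2 * b)) ^ nat \<bar>n\<bar> * (1 / (1 - s\<^sup>2))) summable_on UNIV"
      using s r by (intro summable_on_cmult_left summable_power_nat_abs) auto
    fix n :: int
    have "norm (theta4_dlog_coeff s n / (2 * \<i> * of_int n)) \<le> s ^ nat \<bar>n\<bar> / (1 - s\<^sup>2)"
    proof (cases "n = 0")
      case False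
      have "norm (theta4_dlog_coeff s n / (2 * \<i> * of_int n)) \<le> norm (theta4_dlog_coeff s n) / 2"
        using False unfolding norm_divide by (intro frac_le) (auto simp: norm_mult)
      thus ?thesis using norm_theta4_dlog_coeff_le[OF s, of n] by simp
    qed (use s in \<open>simp add: power_le_one\<close>)
    hence "norm (theta4_dlog_coeff s n / (2 * \<i> * of_int n)) * exp (2 * b) ^ nat \<bar>n\<bar> \<le>
             s ^ nat \<bar>n\<bar> / (1 - s\<^sup>2) * exp (2 * b) ^ nat \<bar>n\<bar>"
      by (intro mult_right_mono) auto
    moreover have "exp (2 * \<bar>real_of_int n\<bar> * b) = exp (2 * b) ^ nat \<bar>n\<bar>"
      by (simp add: mult_ac flip: exp_of_nat_mult)
    ultimately show "norm (theta4_dlog_coeff s n / (2 * \<i> * of_int n)) * exp (2 * \<bar>real_of_int n\<bar> * b)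
            \<le> (s * exp (2 * b)) ^ nat \<bar>n\<bar> * (1 / (1 - s\<^sup>2))"
      by (simp add: power_mult_distrib)
  qed simp
  show "(P has_field_derivative deriv P z) (at z)"
    using fourier_series_derivative(1)[OF * b(1)] unfolding P_def .
  have "2 * \<i> * of_int n * (theta4_dlog_coeff s n / (2 * \<i> * of_int n)) = theta4_dlog_coeff s n" for n
    by (cases "n = 0") auto
  thus "((\<lambda>n. theta4_dlog_coeff s n * exp (2 * \<i> * of_int n * z)) has_sum deriv P z) UNIV"
    using fourier_series_derivative(3)[OF * b(1)] unfolding P_def by simp
qed

text \<open>A Cauchy product: absolute convergence allows the double sum to be regrouped by m = n +
  k. There c (m - n) = c m (-1)^n s^(n^2 - 2 m n), so
  \<open>theta4_log_derivative_coefficient\<close> evaluates the coefficient of e m as (- 2 i c m)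
  (- m).\<close>

lemma theta4_convolution:
  assumes s: "0 < s" "s < 1"
    and H: "((\<lambda>n. theta4_dlog_coeff s n * exp (2 * \<i> * of_int n * z)) has_sum H) UNIV"
  shows "theta4' z (of_real s) = H * theta4 z (of_real s)"
proof -
  define c where "c k = (-1) powi k * complex_of_real s powi (k\<^sup>2)" for k
  define e where "e k = exp (2 * \<i> * of_int k * z)" for k
  let ?f = "\<lambda>(n, k). (theta4_dlog_coeff s n * e n) * (c k * e k)"
  have e_add: "e (m + n) = e m * e n" for m n
    unfolding e_def exp_add[symmetric] by (simp add: algebra_simps)
  have H: "((\<lambda>n. theta4_dlog_coeff s n * e n) has_sum H) UNIV"
    using H by (simp add: e_def)
  have T: "((\<lambda>k. c k * e k) has_sum theta4 z (of_real s)) UNIV"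
    using theta4_has_sum(1)[OF s] by (simp add: c_def e_def)
  have "?f summable_on (UNIV \<times> UNIV)"
  proof (rule summable_on_iff_abs_summable_on_complex[THEN iffD2], rule Infinite_Sum.abs_summable_on_Sigma_iff[THEN iffD2], intro conjI ballI)
    have 1: "(\<lambda>n. norm (theta4_dlog_coeff s n * e n)) summable_on UNIV"
            "(\<lambda>k. norm (c k * e k)) summable_on UNIV"
      using H T by (auto intro: has_sum_imp_summable simp flip: summable_on_iff_abs_summable_on_complex)
    show "(\<lambda>k. norm (?f (n, k))) summable_on UNIV" for n
      using summable_on_cmult_right[OF 1(2), of "norm (theta4_dlog_coeff s n * e n)"]
      by (simp add: norm_mult)
    have "(\<lambda>n. norm (theta4_dlog_coeff s n * e n) * (\<Sum>\<^sub>\<infinity>k. norm (c k * e k))) summable_on UNIV"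
      by (rule summable_on_cmult_left[OF 1(1)])
    thus "(\<lambda>n. norm (\<Sum>\<^sub>\<infinity>k. norm (?f (n, k)))) summable_on UNIV"
      by (simp add: norm_mult infsum_cmult_right' abs_mult infsum_nonneg)
  qed
  then obtain S where S: "(?f has_sum S) (UNIV \<times> UNIV)"
    by (auto simp: summable_on_def)
  \<comment> \<open>Summing over k first factors out theta4; summing over n at fixed m, further
    below, produces theta4'.\<close>
  have "((\<lambda>n. theta4_dlog_coeff s n * e n * theta4 z (of_real s)) has_sum S) UNIV"
    by (rule has_sum_SigmaD[OF S]) (use has_sum_cmult_right[OF T] in simp)
  moreover have "((\<lambda>n. theta4_dlog_coeff s n * e n * theta4 z (of_real s)) has_sum
                    (H * theta4 z (of_real s))) UNIV"
    by (rule has_sum_cmult_left[OF H])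
  ultimately have S_eq: "S = H * theta4 z (of_real s)"
    by (rule has_sum_unique)
  have "e n * e (m - n) = e m" for m n
    using e_add[of n "m - n"] by simp
  hence "((\<lambda>(m, n). theta4_dlog_coeff s n * c (m - n) * e m) has_sum S) (UNIV \<times> UNIV) \<longleftrightarrow>
           (?f has_sum S) (UNIV \<times> UNIV)"
    by (intro has_sum_reindex_bij_witness[of _ "\<lambda>(n, k). (n + k, n)" "\<lambda>(m, n). (n, m - n)"])
       (auto simp: mult.assoc mult.left_commute)
  with S have double: "((\<lambda>(m, n). theta4_dlog_coeff s n * c (m - n) * e m) has_sum S) (UNIV \<times> UNIV)"
    by simp
  have inner: "((\<lambda>n. theta4_dlog_coeff s n * c (m - n) * e m) has_sum (2 * \<i> * of_int m * c m * e m)) UNIV" for m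
  proof -
    define t where "t n = (-1) powi n * s powi (n\<^sup>2 - 2 * m * n) / (s powi (-n) - s powi n)" for n
    have "(m - n)\<^sup>2 = m\<^sup>2 + (n\<^sup>2 - 2 * m * n)" for n
      by (simp add: power2_eq_square algebra_simps)
    moreover have "(-1 :: complex) powi (m - n) = (-1) powi m * (-1) powi n" for n
      using power_int_add[of "-1::complex" m "-n"] by (simp add: power_int_minus_one_minus)
    ultimately have "c (m - n) = c m * of_real ((-1) powi n * s powi (n\<^sup>2 - 2 * m * n))" for n
      using s by (simp add: c_def power_int_add of_real_power_int)
    hence "theta4_dlog_coeff s n * c (m - n) * e m = of_real (t n) * (- 2 * \<i> * c m * e m)" for n
      unfolding theta4_dlog_coeff_def t_def of_real_divide by simp
    thus ?thesis
      using has_sum_cmult_left[OF has_sum_of_real[OF theta4_log_derivative_coefficient[OF s, of m]],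
              of "- 2 * \<i> * c m * e m"]
      by (simp add: t_def mult_ac)
  qed
  have "((\<lambda>m. 2 * \<i> * of_int m * c m * e m) has_sum S) UNIV"
    by (rule has_sum_SigmaD[OF double]) (use inner in simp)
  moreover have "((\<lambda>m. 2 * \<i> * of_int m * c m * e m) has_sum theta4' z (of_real s)) UNIV"
    using theta4_has_sum(2)[OF s] by (simp add: c_def e_def)
  ultimately show ?thesis
    unfolding S_eq[symmetric] using has_sum_unique by (metis (no_types))
qed

text \<open>The relation theta4' = P' theta4 is a linear differential equation of first order: on
  the convex strip its solutions are the multiples of exp P, hence zero everywhere or
  nowhere.\<close>

lemma theta4_nonzero:
  assumes s: "0 < s" "s < 1" and z: "\<bar>Im z\<bar> < - ln s / 2"
  shows "theta4 z (of_real s) \<noteq> 0"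
proof -
  define P where "P w = (\<Sum>\<^sub>\<infinity>n\<in>UNIV. theta4_dlog_coeff s n / (2 * \<i> * of_int n) * exp (2 * \<i> * of_int n * w))" for w
  define S where "S = {w. \<bar>Im w\<bar> < - ln s / 2}"
  let ?f = "\<lambda>w. theta4 w (of_real s) * exp (- P w)"
  have "S = {w. Im w < - ln s / 2} \<inter> {w. Im w > ln s / 2}"
    by (auto simp: S_def)
  hence "convex S"
    by (simp only: convex_Int convex_halfspace_Im_lt convex_halfspace_Im_gt)
  have "(?f has_field_derivative 0) (at w within S)" if "w \<in> S" for w
  proof -
    have P: "(P has_field_derivative deriv P w) (at w)"
            "((\<lambda>n. theta4_dlog_coeff s n * exp (2 * \<i> * of_int n * w)) has_sum deriv P w) UNIV"
      using theta4_dlog_primitive[OF s] that by (auto simp: S_def P_def[abs_def])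
    have "((\<lambda>w. theta4 w (of_real s)) has_field_derivative theta4' w (of_real s)) (at w)"
      using theta4_holomorphic[of "of_real s"] s unfolding theta4'_def
      by (intro holomorphic_derivI[of _ UNIV]) auto
    hence "(?f has_field_derivative
             (theta4' w (of_real s) - deriv P w * theta4 w (of_real s)) * exp (- P w)) (at w)"
      by (auto intro!: derivative_eq_intros P(1) simp: algebra_simps)
    thus ?thesis
      using theta4_convolution[OF s P(2)] by (simp add: has_field_derivative_at_within)
  qed
  hence "\<exists>c. \<forall>w\<in>S. ?f w = c"
    by (rule has_field_derivative_zero_constant[OF \<open>convex S\<close>])
  then obtain c where c: "\<And>w. w \<in> S \<Longrightarrow> ?f w = c"
    by blast
  \<comment> \<open>At pi / 2 the exponentials exp (i pi n) = (-1)^n cancel the signs of the series.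
    What remains is the sum of s^(n^2) > 0, bounded below by its term 1 at n = 0.\<close>
  have "theta4 (of_real pi / 2) (of_real s) \<noteq> 0"
  proof
    assume zero: "theta4 (of_real pi / 2) (of_real s) = 0"
    have eq: "(-1) powi n * complex_of_real s powi n\<^sup>2 * exp (2 * \<i> * of_int n * (of_real pi / 2)) =
                     of_real (s powi n\<^sup>2)" for n
    proof -
      have "exp (2 * \<i> * of_int n * (of_real pi / 2)) = exp (of_int n * (of_real pi * \<i>))"
        by (simp add: mult_ac)
      also have "\<dots> = (-1) powi n"
        by (simp only: exp_power_int[symmetric] exp_pi_i)
      finally have "exp (2 * \<i> * of_int n * (of_real pi / 2)) = (-1) powi n" .
      thus ?thesis by (simp add: flip: power_int_mult_distrib)
    qed
    have "((\<lambda>n. complex_of_real (s powi n\<^sup>2)) has_sum of_real 0) UNIV"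
      using theta4_has_sum(1)[OF s, of "of_real pi / 2"]
      unfolding eq zero by simp
    hence gauss: "((\<lambda>n::int. s powi n\<^sup>2) has_sum 0) UNIV"
      by (subst (asm) has_sum_of_real_iff)
    have delta: "((\<lambda>n::int. of_bool (n = 0)) has_sum (1::real)) UNIV"
      by (rule has_sum_finite_neutralI[of "{0}"]) auto
    have "1 \<le> (0::real)"
      by (rule has_sum_mono[OF delta gauss]) (use s in auto)
    thus False by simp
  qed
  hence "c \<noteq> 0"
    using c[of "pi / 2"] s by (auto simp: S_def)
  with c[of z] z show ?thesis by (auto simp: S_def)
qed

lemma theta4_log_derivative_has_sum:
  assumes s: "0 < s" "s < 1" and z: "\<bar>Im z\<bar> < - ln s / 2"
  shows "((\<lambda>n. theta4_dlog_coeff s n * exp (2 * \<i> * of_int n * z)) has_sum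
            (theta4' z (of_real s) / theta4 z (of_real s))) UNIV"
  using theta4_dlog_primitive(2)[OF assms] theta4_convolution[OF s theta4_dlog_primitive(2)[OF assms]]
    theta4_nonzero[OF assms] by simp

section \<open>Kernels of Chebyshev type\<close>

text \<open>\<open>cheb_sin n \<theta> = U\<^bsub>n-1\<^esub>(cos \<theta>)\<close>, the continuous extension of \<open>sin (n \<theta>) / sin \<theta>\<close>.\<close>
primrec cheb_sin :: "nat \<Rightarrow> real \<Rightarrow> real" where
  "cheb_sin 0 \<theta> = 0"
| "cheb_sin (Suc n) \<theta> = cos \<theta> * cheb_sin n \<theta> + cos (real n * \<theta>)"

lemma cheb_sin_mult_sin: "cheb_sin n \<theta> * sin \<theta> = sin (real n * \<theta>)"
proof (induction n)
  case (Suc n)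
  have "cheb_sin (Suc n) \<theta> * sin \<theta> = cos \<theta> * (cheb_sin n \<theta> * sin \<theta>) + cos (real n * \<theta>) * sin \<theta>"
    by (simp add: algebra_simps)
  also have "\<dots> = sin (real n * \<theta> + \<theta>)"
    by (simp add: Suc.IH sin_add)
  finally show ?case by (simp add: algebra_simps)
qed simp

text \<open>In the proof \<open>cheb_sin n \<theta>\<close> times the square of sin \<theta> stands
  in for sin (n \<theta>) sin \<theta>. Nothing is divided by sin \<theta>, so the three-term
  recurrence also holds at its zeros.\<close>

lemma cheb_sin_Suc_Suc: "cheb_sin (Suc (Suc n)) \<theta> = 2 * cos \<theta> * cheb_sin (Suc n) \<theta> - cheb_sin n \<theta>"
proof -
  have "cos (real (Suc n) * \<theta>) = cos (real n * \<theta> + \<theta>)"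
    by (simp add: algebra_simps)
  also have "\<dots> = cos (real n * \<theta>) * cos \<theta> - cheb_sin n \<theta> * (sin \<theta>)\<^sup>2"
    by (simp add: cos_add power2_eq_square cheb_sin_mult_sin[of n \<theta>, symmetric])
  also have "\<dots> = cos \<theta> * cheb_sin (Suc n) \<theta> - cheb_sin n \<theta>"
    unfolding cheb_sin.simps sin_squared_eq by (simp add: algebra_simps power2_eq_square)
  finally show ?thesis by simp
qed

lemma abs_cheb_sin_le: "\<bar>cheb_sin n \<theta>\<bar> \<le> real n"
proof (induction n)
  case (Suc n)
  have "\<bar>cos \<theta> * cheb_sin n \<theta>\<bar> \<le> 1 * \<bar>cheb_sin n \<theta>\<bar>"
    unfolding abs_mult by (intro mult_right_mono) auto
  hence "\<bar>cheb_sin (Suc n) \<theta>\<bar> \<le> \<bar>cheb_sin n \<theta>\<bar> + 1"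
    using abs_cos_le_one[of "real n * \<theta>"] unfolding cheb_sin.simps by linarith
  with Suc.IH show ?case by simp
qed simp

lemma continuous_on_cheb_sin [continuous_intros]: "continuous_on A (cheb_sin n)"
  by (induction n) (auto intro!: continuous_intros)

text \<open>The kernel of a multiplier: integrated over [-pi, pi] against sin (k \<phi>) with k >=
  1, it gives pi c_k U_(k-1) (cos \<theta>). As |U_(n-1)| <= n, summability of |c n| n makes the
  series converge uniformly in both variables.\<close>

definition sine_kernel :: "(nat \<Rightarrow> real) \<Rightarrow> real \<Rightarrow> real \<Rightarrow> real" where
  "sine_kernel c \<theta> \<phi> = (\<Sum>n. c n * cheb_sin n \<theta> * sin (real n * \<phi>))"

lemma norm_sine_kernel_term_le: "norm (c n * cheb_sin n \<theta> * sin (real n * \<phi>)) \<le> \<bar>c n\<bar> * real n"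
proof -
  have "\<bar>c n\<bar> * \<bar>cheb_sin n \<theta>\<bar> * \<bar>sin (real n * \<phi>)\<bar> \<le> \<bar>c n\<bar> * real n * 1"
    by (intro mult_mono abs_cheb_sin_le) auto
  thus ?thesis by (simp add: abs_mult)
qed

lemma sine_kernel_uniform_limit:
  assumes "summable (\<lambda>n. \<bar>c n\<bar> * real n)"
  shows "uniform_limit A (\<lambda>k (\<theta>, \<phi>). \<Sum>n<k. c n * cheb_sin n \<theta> * sin (real n * \<phi>))
           (\<lambda>(\<theta>, \<phi>). sine_kernel c \<theta> \<phi>) sequentially"
  unfolding sine_kernel_def case_prod_unfold
  by (rule Weierstrass_m_test[OF _ assms]) (rule norm_sine_kernel_term_le)

lemma sine_kernel_sums:
  assumes "summable (\<lambda>n. \<bar>c n\<bar> * real n)"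
  shows "(\<lambda>n. c n * cheb_sin n \<theta> * sin (real n * \<phi>)) sums sine_kernel c \<theta> \<phi>"
  unfolding sine_kernel_def
  by (rule summable_sums, rule summable_comparison_test'[OF assms]) (rule norm_sine_kernel_term_le)

lemma abs_sine_kernel_le:
  assumes "summable (\<lambda>n. \<bar>c n\<bar> * real n)"
  shows "\<bar>sine_kernel c \<theta> \<phi>\<bar> \<le> (\<Sum>n. \<bar>c n\<bar> * real n)"
  using norm_sums_le[OF sine_kernel_sums[OF assms] summable_sums[OF assms] norm_sine_kernel_term_le[of c]]
  by simp

lemma continuous_on_sine_kernel_pair:
  assumes "summable (\<lambda>n. \<bar>c n\<bar> * real n)"
  shows "continuous_on UNIV (\<lambda>(\<theta>, \<phi>). sine_kernel c \<theta> \<phi>)"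
proof (rule uniform_limit_theorem[OF _ sine_kernel_uniform_limit[OF assms]])
  have "continuous_on UNIV (\<lambda>x. cheb_sin n (fst x))" for n
    by (rule continuous_on_compose2[OF continuous_on_cheb_sin[of UNIV]]) (auto intro!: continuous_intros)
  thus "\<forall>\<^sub>F k in sequentially. continuous_on UNIV (\<lambda>(\<theta>, \<phi>). \<Sum>n<k. c n * cheb_sin n \<theta> * sin (real n * \<phi>))"
    unfolding case_prod_unfold by (intro always_eventually allI continuous_intros)
qed simp

lemma continuous_on_sine_kernel [continuous_intros]:
  assumes "summable (\<lambda>n. \<bar>c n\<bar> * real n)" "continuous_on A f" "continuous_on A g"
  shows "continuous_on A (\<lambda>x. sine_kernel c (f x) (g x))"
  using continuous_on_compose2[OF continuous_on_sine_kernel_pair[OF assms(1)] continuous_on_Pair[OF assms(2,3)]]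
  by simp

lemma has_integral_sin_mult_sin:
  "((\<lambda>\<phi>. sin (real n * \<phi>) * sin \<phi>) has_integral (if n = 1 then pi else 0)) {-pi..pi}"
proof -
  have sin_pi_mult: "sin ((real n + 1) * pi) = 0" "sin ((real n - 1) * pi) = 0" for n
    using sin_npi_int[of "int n + 1"] sin_npi_int[of "int n - 1"] by (simp_all add: mult.commute)
  show ?thesis
  proof (cases "n = 1")
    case True
    have "((\<lambda>\<phi>. sin \<phi> * sin \<phi>) has_integral ((pi - sin pi * cos pi) / 2 - (- pi - sin (-pi) * cos (-pi)) / 2)) {-pi..pi}"
    proof (rule fundamental_theorem_of_calculus)
      fix x
      have "((\<lambda>x. (x - sin x * cos x) / 2) has_real_derivative (1 - ((cos x)\<^sup>2 - (sin x)\<^sup>2)) / 2) (at x within {-pi..pi})"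
        by (auto intro!: derivative_eq_intros simp: power2_eq_square)
      moreover have "(1 - ((cos x)\<^sup>2 - (sin x)\<^sup>2)) / 2 = sin x * sin x"
        by (simp add: cos_squared_eq) (simp add: power2_eq_square)
      ultimately show "((\<lambda>x. (x - sin x * cos x) / 2) has_vector_derivative sin x * sin x) (at x within {-pi..pi})"
        by (simp add: has_real_derivative_iff_has_vector_derivative)
    qed simp
    thus ?thesis using True by simp
  next
    case False
    let ?F = "\<lambda>x. (sin ((real n - 1) * x) / (real n - 1) - sin ((real n + 1) * x) / (real n + 1)) / 2"
    have "((\<lambda>\<phi>. sin (real n * \<phi>) * sin \<phi>) has_integral (?F pi - ?F (-pi))) {-pi..pi}"
    proof (rule fundamental_theorem_of_calculus)
      fix x
      have "real n - 1 \<noteq> 0" "real n + 1 \<noteq> 0"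
        using False by auto
      hence "(?F has_real_derivative (cos ((real n - 1) * x) - cos ((real n + 1) * x)) / 2) (at x within {-pi..pi})"
        by (auto intro!: derivative_eq_intros)
      moreover have "(cos ((real n - 1) * x) - cos ((real n + 1) * x)) / 2 = sin (real n * x) * sin x"
        by (simp add: sin_times_sin left_diff_distrib distrib_right)
      ultimately show "(?F has_vector_derivative sin (real n * x) * sin x) (at x within {-pi..pi})"
        by (simp add: has_real_derivative_iff_has_vector_derivative)
    qed simp
    thus ?thesis using False sin_pi_mult by simp
  qed
qed

text \<open>By orthogonality only n = 1 survives, where \<open>cheb_sin 1 \<theta>\<close> is 1. The
  mass is therefore independent of \<theta>; for the weights r^n it is pi r.\<close>

lemma has_integral_sine_kernel_sin:
  assumes "summable (\<lambda>n. \<bar>c n\<bar> * real n)"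
  shows "((\<lambda>\<phi>. sine_kernel c \<theta> \<phi> * sin \<phi>) has_integral pi * c 1) {-pi..pi}"
proof -
  let ?t = "\<lambda>n \<phi>. c n * cheb_sin n \<theta> * sin (real n * \<phi>)"
  have part: "((\<lambda>\<phi>. (\<Sum>n<k. ?t n \<phi>) * sin \<phi>) has_integral (\<Sum>n<k. if n = 1 then pi * c 1 else 0)) {-pi..pi}" for k
  proof -
    have "((\<lambda>\<phi>. ?t n \<phi> * sin \<phi>) has_integral (if n = 1 then pi * c 1 else 0)) {-pi..pi}" for n
      using has_integral_mult_right[OF has_integral_sin_mult_sin[of n], of "c n * cheb_sin n \<theta>"]
      by (auto simp: mult_ac split: if_splits)
    thus ?thesis
      by (simp only: sum_distrib_right) (intro has_integral_sum, auto)
  qed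
  let ?M = "\<Sum>n. \<bar>c n\<bar> * real n"
  show ?thesis
  proof (rule has_integral_dominated_convergence[OF part])
    show "(\<lambda>_. ?M) integrable_on {-pi..pi}" by (rule integrable_const_ivl)
    show "\<forall>\<phi>\<in>{-pi..pi}. norm ((\<Sum>n<k. ?t n \<phi>) * sin \<phi>) \<le> ?M" for k
    proof
      fix \<phi>
      have "norm (\<Sum>n<k. ?t n \<phi>) \<le> (\<Sum>n<k. \<bar>c n\<bar> * real n)"
        by (intro sum_norm_le norm_sine_kernel_term_le)
      also have "\<dots> \<le> ?M"
        by (intro sum_le_suminf assms) auto
      finally have "norm (\<Sum>n<k. ?t n \<phi>) * \<bar>sin \<phi>\<bar> \<le> ?M * 1"
        by (intro mult_mono) auto
      thus "norm ((\<Sum>n<k. ?t n \<phi>) * sin \<phi>) \<le> ?M" by (simp add: abs_mult)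
    qed
    show "\<forall>\<phi>\<in>{-pi..pi}. (\<lambda>k. (\<Sum>n<k. ?t n \<phi>) * sin \<phi>) \<longlonglongrightarrow> sine_kernel c \<theta> \<phi> * sin \<phi>"
      using sine_kernel_sums[OF assms] by (auto intro!: tendsto_intros simp: sums_def)
    show "(\<lambda>k. \<Sum>n<k. if n = 1 then pi * c 1 else 0) \<longlonglongrightarrow> pi * c 1"
      using sums_single[of 1 "\<lambda>_. pi * c 1"] unfolding sums_def .
  qed
qed

lemma summable_power_mult_of_nat:
  fixes r :: real
  assumes "0 \<le> r" "r < 1"
  shows "summable (\<lambda>n. \<bar>r ^ n\<bar> * real n)"
proof -
  have "summable (\<lambda>n. of_nat (Suc n) * r ^ n)"
    using geometric_deriv_sums[of r] assms by (auto simp: sums_iff)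
  thus ?thesis
    by (rule summable_comparison_test') (use assms in \<open>simp add: algebra_simps\<close>)
qed

text \<open>The three-term recurrence makes the sum S a solution of S - t = 2 cos \<theta> t S - t^2
  S. The denominator factors as (1 - e^(i\<theta>) t) (1 - e^(-i\<theta>) t), which has no zero in
  the open unit disc.\<close>

lemma cheb_sin_generating_function:
  fixes t :: complex
  assumes "norm t < 1"
  shows "(\<lambda>n. of_real (cheb_sin n \<theta>) * t ^ n) sums (t / (1 - 2 * of_real (cos \<theta>) * t + t\<^sup>2))"
    and "1 - 2 * of_real (cos \<theta>) * t + t\<^sup>2 \<noteq> 0"
proof -
  have factor: "1 - 2 * of_real (cos \<theta>) * t + t\<^sup>2 = (1 - cis \<theta> * t) * (1 - cis (-\<theta>) * t)"
  proof -
    have "cis \<theta> + cis (-\<theta>) = 2 * of_real (cos \<theta>)" "cis \<theta> * cis (-\<theta>) = 1"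
      by (auto simp: complex_eq_iff cis_mult)
    thus ?thesis
      by (simp add: algebra_simps power2_eq_square) (metis (no_types, opaque_lifting) distrib_left mult.assoc mult.left_commute mult.right_neutral mult_2)
  qed
  have "1 - cis \<alpha> * t \<noteq> 0" for \<alpha>
  proof
    assume "1 - cis \<alpha> * t = 0"
    hence "norm (cis \<alpha> * t) = norm (1::complex)" by simp
    thus False using assms by (simp add: norm_mult)
  qed
  thus nz: "1 - 2 * of_real (cos \<theta>) * t + t\<^sup>2 \<noteq> 0"
    unfolding factor by simp
  have "summable (\<lambda>n. of_real (cheb_sin n \<theta>) * t ^ n)"
  proof (rule summable_comparison_test'[OF summable_power_mult_of_nat[of "norm t"]])
    fix n
    show "norm (of_real (cheb_sin n \<theta>) * t ^ n) \<le> \<bar>norm t ^ n\<bar> * real n"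
      by (simp add: norm_mult norm_power mult.commute[of "norm t ^ n"] mult_right_mono abs_cheb_sin_le)
  qed (use assms in auto)
  then obtain S where S: "(\<lambda>n. of_real (cheb_sin n \<theta>) * t ^ n) sums S"
    by (auto simp: summable_def)
  \<comment> \<open>Term 0 vanishes, so the first shift keeps the sum; the second one removes the
    term t, as U_0 = 1.\<close>
  have S1: "(\<lambda>n. of_real (cheb_sin (Suc n) \<theta>) * t ^ Suc n) sums S"
    using S by (subst sums_Suc_iff) simp
  have "(\<lambda>n. of_real (cheb_sin (Suc (Suc n)) \<theta>) * t ^ Suc (Suc n)) sums (S - t)"
    using S1 by (subst sums_Suc_iff) simp
  moreover have "(\<lambda>n. 2 * of_real (cos \<theta>) * t * (of_real (cheb_sin (Suc n) \<theta>) * t ^ Suc n) -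
                   t\<^sup>2 * (of_real (cheb_sin n \<theta>) * t ^ n)) sums (2 * of_real (cos \<theta>) * t * S - t\<^sup>2 * S)"
    by (intro sums_diff sums_mult S S1)
  hence "(\<lambda>n. of_real (cheb_sin (Suc (Suc n)) \<theta>) * t ^ Suc (Suc n)) sums (2 * of_real (cos \<theta>) * t * S - t\<^sup>2 * S)"
    unfolding cheb_sin_Suc_Suc by (simp add: algebra_simps power2_eq_square)
  ultimately have "S - t = 2 * of_real (cos \<theta>) * t * S - t\<^sup>2 * S"
    by (rule sums_unique2)
  hence "S * (1 - 2 * of_real (cos \<theta>) * t + t\<^sup>2) = t"
    by (simp add: algebra_simps)
  hence "S = t / (1 - 2 * of_real (cos \<theta>) * t + t\<^sup>2)"
    using nz by (simp add: nonzero_eq_divide_eq)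
  with S show "(\<lambda>n. of_real (cheb_sin n \<theta>) * t ^ n) sums (t / (1 - 2 * of_real (cos \<theta>) * t + t\<^sup>2))"
    by simp
qed

text \<open>This is the imaginary part of the generating function t / D at t = r e^(i\<phi>). After
  multiplication by cnj D, the relation t cnj t = r^2 makes the part of the numerator that depends
  on \<theta> real. The closed form shows the sign, which the series does not.\<close>

lemma sine_kernel_power:
  assumes r: "0 < r" "r < 1"
  shows "sine_kernel (\<lambda>n. r ^ n) \<theta> \<phi> =
           r * (1 - r\<^sup>2) * sin \<phi> / (norm (1 - 2 * of_real (cos \<theta>) * rcis r \<phi> + (rcis r \<phi>)\<^sup>2))\<^sup>2"
proof -
  define t where "t = rcis r \<phi>"
  define D where "D = 1 - 2 * of_real (cos \<theta>) * t + t\<^sup>2"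
  have t: "norm t < 1" using r by (simp add: t_def)
  have "(\<lambda>n. of_real (cheb_sin n \<theta>) * t ^ n) sums (t / D)"
    using cheb_sin_generating_function(1)[OF t] by (simp add: D_def)
  hence "(\<lambda>n. Im (of_real (cheb_sin n \<theta>) * t ^ n)) sums Im (t / D)"
    by (rule sums_Im)
  hence "(\<lambda>n. r ^ n * cheb_sin n \<theta> * sin (real n * \<phi>)) sums Im (t / D)"
    by (simp add: t_def DeMoivre2 mult_ac)
  with sine_kernel_sums[OF summable_power_mult_of_nat[of r], of \<theta> \<phi>] r
  have "sine_kernel (\<lambda>n. r ^ n) \<theta> \<phi> = Im (t / D)"
    using sums_unique2 by fastforce
  also have "\<dots> = Im (t * cnj D) / (norm D)\<^sup>2"
    by (subst complex_div_cnj) simp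
  also have "t * cnj D = t - of_real (2 * cos \<theta> * r\<^sup>2) + of_real (r\<^sup>2) * cnj t"
  proof -
    have "t * cnj t = of_real (r\<^sup>2)"
      using r by (simp add: complex_norm_square[symmetric] t_def)
    moreover have "t * cnj D = t - of_real (2 * cos \<theta>) * (t * cnj t) + (t * cnj t) * cnj t"
      by (simp add: D_def algebra_simps power2_eq_square)
    ultimately show ?thesis by simp
  qed
  also have "Im \<dots> = r * (1 - r\<^sup>2) * sin \<phi>"
    by (simp add: t_def rcis_def algebra_simps)
  finally show ?thesis by (simp add: D_def t_def)
qed

lemma sine_kernel_power_nonneg:
  assumes "0 < r" "r < 1"
  shows "0 \<le> sine_kernel (\<lambda>n. r ^ n) \<theta> \<phi> * sin \<phi>"
proof -
  have "r\<^sup>2 \<le> 1" using assms by (simp add: power_le_one)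
  hence "0 \<le> r * (1 - r\<^sup>2) * (sin \<phi>)\<^sup>2"
    using assms by (intro mult_nonneg_nonneg) auto
  thus ?thesis
    unfolding sine_kernel_power[OF assms] times_divide_eq_left
    by (intro divide_nonneg_nonneg) (simp_all add: mult.assoc power2_eq_square)
qed

text \<open>D / t = t + 1 / t - 2 cos \<theta> has real part (r + 1/r - 2) cos \<phi> + 2 (cos
  \<phi> - cos \<theta>). The second summand has size at least 2 \<delta> and the first at most
  \<delta>, so |D| >= r \<delta>. Measuring distance by cosines treats \<phi> = \<theta> and \<phi>
  = - \<theta> together.\<close>

lemma sine_kernel_power_bound:
  assumes r: "0 < r" "r < 1" and \<delta>: "0 < \<delta>" "\<delta> \<le> \<bar>cos \<phi> - cos \<theta>\<bar>" "r + 1 / r - 2 \<le> \<delta>"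
  shows "sine_kernel (\<lambda>n. r ^ n) \<theta> \<phi> * sin \<phi> \<le> (1 - r\<^sup>2) / (r * \<delta>\<^sup>2)"
proof -
  define t where "t = rcis r \<phi>"
  define D where "D = 1 - 2 * of_real (cos \<theta>) * t + t\<^sup>2"
  have t: "t \<noteq> 0" "norm t = r" using r by (auto simp: t_def)
  have "D = t * (t + 1 / t - 2 * of_real (cos \<theta>))"
    using t by (simp add: D_def field_simps power2_eq_square)
  hence "norm D = r * norm (t + 1 / t - 2 * of_real (cos \<theta>))"
    using t by (simp add: norm_mult)
  also have "\<dots> \<ge> r * \<bar>Re (t + 1 / t - 2 * of_real (cos \<theta>))\<bar>"
    using r by (intro mult_left_mono abs_Re_le_cmod) auto
  finally have 1: "r * \<bar>Re (t + 1 / t - 2 * of_real (cos \<theta>))\<bar> \<le> norm D" .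
  have "1 / t = rcis (1 / r) (-\<phi>)"
    using rcis_inverse[of r \<phi>] by (simp add: t_def divide_inverse)
  hence Re: "Re (t + 1 / t - 2 * of_real (cos \<theta>)) = (r + 1 / r - 2) * cos \<phi> + 2 * (cos \<phi> - cos \<theta>)"
    by (simp add: t_def algebra_simps)
  have "0 \<le> (1 - r)\<^sup>2 / r" using r by simp
  also have "(1 - r)\<^sup>2 / r = r + 1 / r - 2"
    using r by (simp add: field_simps power2_eq_square)
  finally have "\<bar>(r + 1 / r - 2) * cos \<phi>\<bar> \<le> (r + 1 / r - 2) * 1"
    unfolding abs_mult by (intro mult_mono) auto
  moreover have "\<delta> \<le> \<bar>w + 2 * v\<bar>" if "\<delta> \<le> \<bar>v\<bar>" "\<bar>w\<bar> \<le> \<delta>" for v w :: real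
    using that by linarith
  ultimately have "\<delta> \<le> \<bar>Re (t + 1 / t - 2 * of_real (cos \<theta>))\<bar>"
    unfolding Re using \<delta> by auto
  hence "r * \<delta> \<le> norm D"
    using 1 r by (meson mult_left_mono less_imp_le order_trans)
  hence "(r * \<delta>)\<^sup>2 \<le> (norm D)\<^sup>2"
    using r \<delta> by (intro power_mono) auto
  moreover have "r\<^sup>2 \<le> 1" using r by (simp add: power_le_one)
  moreover have "(sin \<phi>)\<^sup>2 \<le> 1" by (simp add: abs_square_le_1)
  ultimately have "r * (1 - r\<^sup>2) * (sin \<phi>)\<^sup>2 / (norm D)\<^sup>2 \<le> r * (1 - r\<^sup>2) * 1 / (r * \<delta>)\<^sup>2"
    using r \<delta> by (intro frac_le mult_left_mono) auto
  also have "\<dots> = (1 - r\<^sup>2) / (r * \<delta>\<^sup>2)"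
    using r \<delta> by (simp add: power_mult_distrib power2_eq_square[of r] mult.assoc)
  finally show ?thesis
    unfolding sine_kernel_power[OF r] by (simp add: D_def t_def power2_eq_square)
qed

section \<open>The integral representation\<close>

text \<open>Pairing n with - n is what later produces the sines. The term at 0 would be counted
  twice, hence the condition on it.\<close>

lemma has_sum_int_imp_sums:
  fixes f :: "int \<Rightarrow> 'a :: banach"
  assumes "(f has_sum S) UNIV" "f 0 = 0"
  shows "(\<lambda>n. f (int n) + f (- int n)) sums S"
proof -
  let ?m = "\<lambda>n. - int (Suc n)"
  have f: "f summable_on UNIV"
    using assms by (auto simp: summable_on_def)
  obtain S1 S2 where S: "(f has_sum S1) (range int)" "(f has_sum S2) (range ?m)"
    using summable_on_subset_banach[OF f] unfolding summable_on_def by (metis subset_UNIV)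
  have "(f has_sum (S1 + S2)) (range int \<union> range ?m)"
    by (rule has_sum_Un_disjoint[OF S]) auto
  moreover have "n \<in> range int \<or> n \<in> range ?m" for n
    by (cases n rule: int_cases) auto
  hence "range int \<union> range ?m = UNIV" by auto
  ultimately have S_eq: "S = S1 + S2"
    using has_sum_unique[OF assms(1)] by metis
  have "((f \<circ> int) has_sum S1) UNIV" "((f \<circ> ?m) has_sum S2) UNIV"
    using S by (subst (asm) has_sum_reindex; force simp: inj_def)+
  hence "(\<lambda>n. f (int n)) sums S1" "(\<lambda>n. f (?m n)) sums S2"
    using has_sum_imp_sums by (fastforce simp: o_def)+
  moreover from this(2) have "(\<lambda>n. f (- int n)) sums S2"
    using sums_Suc_iff[of "\<lambda>n. f (- int n)" S2] assms(2) by simp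
  ultimately show ?thesis
    unfolding S_eq by (intro sums_add)
qed

section \<open>Comparison of the multipliers with powers of s / a\<close>

text \<open>This is rho_n for s = sqrt q and a = sqrt p. At n = 0 it is 0 / 0 = 0, whereas (s / a)^0
  = 1; the kernels do not see the difference because \<open>cheb_sin 0 \<theta>\<close> is
  0.\<close>

definition AW_mult :: "real \<Rightarrow> real \<Rightarrow> nat \<Rightarrow> real" where
  "AW_mult s a n = (inverse a ^ n - a ^ n) / (inverse s ^ n - s ^ n)"

lemma AW_mult_eq:
  assumes "0 < s" "0 < a"
  shows "AW_mult s a n = (s / a) ^ n * ((1 - (a\<^sup>2) ^ n) / (1 - (s\<^sup>2) ^ n))"
proof -
  have *: "inverse x ^ n - x ^ n = (1 - (x\<^sup>2) ^ n) / x ^ n" if "0 < x" for x :: real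
  proof -
    have "(x\<^sup>2) ^ n = x ^ n * x ^ n"
      by (simp add: power2_eq_square power_mult_distrib)
    thus ?thesis
      using that by (simp add: field_simps)
  qed
  show ?thesis
    unfolding AW_mult_def *[OF assms(1)] *[OF assms(2)] by (simp add: power_divide)
qed

lemma AW_mult_bounds:
  assumes s: "0 < s" "s < a" "a < 1"
  shows "0 \<le> AW_mult s a n" "AW_mult s a n \<le> (s / a) ^ n"
proof -
  have "(s\<^sup>2) ^ n \<le> (a\<^sup>2) ^ n"
    using s by (intro power_mono) auto
  moreover have "(a\<^sup>2) ^ n \<le> 1"
    using s by (intro power_le_one) (auto intro: power_le_one)
  ultimately have "0 \<le> (1 - (a\<^sup>2) ^ n) / (1 - (s\<^sup>2) ^ n)" "(1 - (a\<^sup>2) ^ n) / (1 - (s\<^sup>2) ^ n) \<le> 1"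
    by (auto simp: divide_le_eq_1)
  moreover have "0 \<le> (s / a) ^ n" using s by simp
  ultimately show "0 \<le> AW_mult s a n" "AW_mult s a n \<le> (s / a) ^ n"
    unfolding AW_mult_eq[OF s(1) less_trans[OF s(1,2)]] by (auto intro: mult_left_le mult_nonneg_nonneg simp del: times_divide_eq_right)
qed

lemma summable_AW_mult:
  assumes s: "0 < s" "s < a" "a < 1"
  shows "summable (\<lambda>n. \<bar>AW_mult s a n\<bar> * real n)"
proof (rule summable_comparison_test'[OF summable_power_mult_of_nat[of "s / a"]])
  show "norm (\<bar>AW_mult s a n\<bar> * real n) \<le> \<bar>(s / a) ^ n\<bar> * real n" for n
    using AW_mult_bounds[OF s, of n] s by (auto intro!: mult_right_mono)
qed (use s in auto)

text \<open>A mean value estimate without derivatives; it extracts the factor p - q from p^n -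
  q^n.\<close>

lemma power_diff_le:
  fixes x y b :: real
  assumes "0 \<le> x" "x \<le> y" "y \<le> b"
  shows "y ^ n - x ^ n \<le> real n * b ^ (n - 1) * (y - x)"
proof (induction n)
  case (Suc n)
  have "y ^ Suc n - x ^ Suc n = y * (y ^ n - x ^ n) + x ^ n * (y - x)"
    by (simp add: algebra_simps)
  also have "\<dots> \<le> b * (real n * b ^ (n - 1) * (y - x)) + b ^ n * (y - x)"
    using assms Suc.IH by (intro add_mono mult_mono mult_right_mono power_mono) (auto intro: power_mono)
  also have "\<dots> = real (Suc n) * b ^ (Suc n - 1) * (y - x)"
    by (cases n) (auto simp: algebra_simps)
  finally show ?case .
qed simp

lemma summable_square_mult_power:
  fixes b :: real
  assumes "0 \<le> b" "b < 1"
  shows "summable (\<lambda>n. real n * (real n * b ^ (n - 1)))"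
proof -
  \<comment> \<open>Differentiating the geometric series twice gives the coefficients (n + 1) (n +
    2), which dominate (n + 1)^2.\<close>
  have "summable (\<lambda>n. diffs (diffs (\<lambda>_. 1)) n * b ^ n)"
  proof (rule termdiff_converges[of b 1])
    fix x :: real
    assume "norm x < 1"
    thus "summable (\<lambda>n. diffs (\<lambda>_. 1) n * x ^ n)"
      by (intro termdiff_converges[of x 1]) (auto simp: summable_geometric)
  qed (use assms in auto)
  hence "summable (\<lambda>n. real (Suc n) * (real (Suc n) * b ^ n))"
  proof (rule summable_comparison_test'[where N = 0])
    fix n
    have "real (Suc n) * (real (Suc n) * b ^ n) \<le> real (Suc n) * (real (Suc (Suc n)) * b ^ n)"
      using assms by (intro mult_left_mono mult_right_mono) auto
    thus "norm (real (Suc n) * (real (Suc n) * b ^ n)) \<le> diffs (diffs (\<lambda>_. 1)) n * b ^ n"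
      using assms by (simp add: diffs_def mult.assoc)
  qed
  thus ?thesis
    using summable_Suc_iff[of "\<lambda>n. real n * (real n * b ^ (n - 1))"] by simp
qed

text \<open>Put p = a^2 and q = s^2. For n >= 1 the weights differ by (s / a)^n (p^n - q^n) / (1 -
  q^n), where (s / a)^n <= 1, 1 - q^n >= 1 - q and p^n - q^n <= n b^(n-1) (p - q). The second factor
  n in the sum comes from \<open>abs_cheb_sin_le\<close>. Using b in place of p keeps the series
  independent of p.\<close>

lemma sine_kernel_AW_mult_approx:
  assumes s: "0 < s" "s < a" "a\<^sup>2 \<le> b" "b < 1"
  shows "\<bar>sine_kernel (\<lambda>n. (s / a) ^ n) \<theta> \<phi> - sine_kernel (AW_mult s a) \<theta> \<phi>\<bar> \<le>
           (a\<^sup>2 - s\<^sup>2) * ((\<Sum>n. real n * (real n * b ^ (n - 1))) / (1 - s\<^sup>2))"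
proof -
  have "a\<^sup>2 < 1" using s by simp
  hence a: "a < 1" using s by (simp add: power_less_one_iff)
  have s2: "s\<^sup>2 < a\<^sup>2" "s\<^sup>2 < 1"
    using s a by (auto simp: power_strict_mono power_less_one_iff)
  have "0 \<le> a\<^sup>2" by simp
  hence b: "0 \<le> b" "b < 1" using s by linarith+
  define d where "d n = (s / a) ^ n - AW_mult s a n" for n
  define K where "K = (a\<^sup>2 - s\<^sup>2) / (1 - s\<^sup>2)"
  have d: "\<bar>d n\<bar> * real n \<le> K * (real n * (real n * b ^ (n - 1)))" for n
  proof (cases "n = 0")
    case False
    have s2n: "(s\<^sup>2) ^ n \<le> s\<^sup>2"
      using power_decreasing[of 1 n "s\<^sup>2"] False s2 by simp
    have "d n = (s / a) ^ n * (((a\<^sup>2) ^ n - (s\<^sup>2) ^ n) / (1 - (s\<^sup>2) ^ n))"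
      using s s2 s2n unfolding d_def AW_mult_eq[OF s(1) less_trans[OF s(1,2)]]
      by (simp add: field_simps)
    also have "\<dots> \<le> 1 * ((real n * b ^ (n - 1) * (a\<^sup>2 - s\<^sup>2)) / (1 - s\<^sup>2))"
      using s s2 s2n b by (intro mult_mono frac_le power_diff_le) (auto intro!: power_le_one divide_nonneg_nonneg power_mono mult_nonneg_nonneg)
    finally have "d n \<le> K * (real n * b ^ (n - 1))"
      by (simp add: K_def mult_ac)
    moreover have "0 \<le> d n"
      using AW_mult_bounds[OF s(1,2) a, of n] by (simp add: d_def)
    ultimately have "\<bar>d n\<bar> * real n \<le> K * (real n * b ^ (n - 1)) * real n"
      by (intro mult_right_mono) auto
    thus ?thesis by (simp add: mult_ac)
  qed simp
  have sums_b: "(\<lambda>n. K * (real n * (real n * b ^ (n - 1)))) sums (K * (\<Sum>n. real n * (real n * b ^ (n - 1))))"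
    by (intro sums_mult summable_sums summable_square_mult_power b)
  have summ_d: "summable (\<lambda>n. \<bar>d n\<bar> * real n)"
    by (rule summable_comparison_test'[OF sums_summable[OF sums_b]]) (use d in auto)
  have r: "0 \<le> s / a" "s / a < 1"
    using s by auto
  have "(\<lambda>n. d n * cheb_sin n \<theta> * sin (real n * \<phi>)) sums
          (sine_kernel (\<lambda>n. (s / a) ^ n) \<theta> \<phi> - sine_kernel (AW_mult s a) \<theta> \<phi>)"
    using sums_diff[OF sine_kernel_sums[OF summable_power_mult_of_nat[OF r]]
                       sine_kernel_sums[OF summable_AW_mult[OF s(1,2) a]], of \<theta> \<phi> \<theta> \<phi>]
    by (simp add: d_def algebra_simps)
  moreover note sine_kernel_sums[OF summ_d, of \<theta> \<phi>]
  ultimately have "sine_kernel (\<lambda>n. (s / a) ^ n) \<theta> \<phi> - sine_kernel (AW_mult s a) \<theta> \<phi> = sine_kernel d \<theta> \<phi>"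
    by (rule sums_unique2)
  moreover have "\<bar>sine_kernel d \<theta> \<phi>\<bar> \<le> (\<Sum>n. \<bar>d n\<bar> * real n)"
    by (rule abs_sine_kernel_le[OF summ_d])
  moreover have "(\<Sum>n. \<bar>d n\<bar> * real n) \<le> K * (\<Sum>n. real n * (real n * b ^ (n - 1)))"
    by (rule sums_le[OF d summable_sums[OF summ_d] sums_b])
  ultimately show ?thesis by (simp add: K_def)
qed

section \<open>The divided difference of the inverse operator as an integral\<close>

text \<open>Here y = - ln a stands for the point a e^(i\<theta>) and y = ln a for e^(i\<theta>) / a.
  The constant - 8 i is (2 i)^3: one factor comes from the difference in y together with the
  coefficient, one from antisymmetrising in \<phi>, and one from pairing n with - n, which yields
  sin (n \<theta>) = \<open>cheb_sin n \<theta>\<close> sin \<theta>.\<close>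

lemma theta4_log_derivative_difference:
  fixes s a \<theta> \<phi> :: real
  assumes s: "0 < s" "s < a" "a < 1"
  defines "L \<equiv> \<lambda>z. theta4' z (of_real s) / theta4 z (of_real s)"
    and "k \<equiv> \<lambda>y t. (of_real \<theta> + \<i> * of_real y + of_real t) / 2"
  shows "L (k (- ln a) \<phi>) - L (k (ln a) \<phi>) - (L (k (- ln a) (-\<phi>)) - L (k (ln a) (-\<phi>))) =
           - 8 * \<i> * of_real (sin \<theta> * sine_kernel (AW_mult s a) \<theta> \<phi>)"
proof -
  let ?E = "\<lambda>n z. exp (2 * \<i> * of_int n * z)"
  define f where "f n = theta4_dlog_coeff s n * ((?E n (k (- ln a) \<phi>) - ?E n (k (ln a) \<phi>))
      - (?E n (k (- ln a) (-\<phi>)) - ?E n (k (ln a) (-\<phi>))))" for n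
  have ln: "ln a < 0" "ln s < ln a"
    using s by auto
  \<comment> \<open>The argument \<open>k y t\<close> has imaginary part y / 2, so |y| < - ln s
    describes the strip; y = ln a and y = - ln a qualify because s < a.\<close>
  have L: "((\<lambda>n. theta4_dlog_coeff s n * ?E n (k y t)) has_sum L (k y t)) UNIV" if "\<bar>y\<bar> < - ln s" for y t
    unfolding L_def by (rule theta4_log_derivative_has_sum) (use s that in \<open>auto simp: k_def\<close>)
  have minus: "((\<lambda>n. x n - y n) has_sum (X - Y)) UNIV"
    if "(x has_sum X) UNIV" "(y has_sum Y) UNIV" for x y :: "int \<Rightarrow> complex" and X Y
    using has_sum_add[OF that(1) has_sum_uminusI[OF that(2)]] by simp
  have "(f has_sum (L (k (- ln a) \<phi>) - L (k (ln a) \<phi>) - (L (k (- ln a) (-\<phi>)) - L (k (ln a) (-\<phi>))))) UNIV"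
    unfolding f_def right_diff_distrib by (intro minus L) (use ln in auto)
  hence sums: "(\<lambda>n. f (int n) + f (- int n)) sums
      (L (k (- ln a) \<phi>) - L (k (ln a) \<phi>) - (L (k (- ln a) (-\<phi>)) - L (k (ln a) (-\<phi>))))"
    by (rule has_sum_int_imp_sums) (simp add: f_def)
  have E: "?E n (k y t) = of_real (exp (- (of_int n * y))) * cis (of_int n * \<theta>) * cis (of_int n * t)" for n y t
  proof -
    have "2 * \<i> * of_int n * k y t =
            of_real (- (of_int n * y)) + \<i> * of_real (of_int n * \<theta>) + \<i> * of_real (of_int n * t)"
      by (simp add: k_def field_simps)
    thus ?thesis
      by (simp only: exp_add cis_conv_exp exp_of_real)
  qed
  have exp_ln: "exp (real n * ln a) = a ^ n" "exp (- (real n * ln a)) = inverse a ^ n" for n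
    using s by (simp_all add: exp_of_nat_mult exp_minus power_inverse)
  have cis_diff: "cis x - cis (-x) = 2 * \<i> * of_real (sin x)" for x
    by (simp add: complex_eq_iff)
  have "f (int n) + f (- int n) =
          - 8 * \<i> * of_real (sin \<theta>) * of_real (AW_mult s a n * cheb_sin n \<theta> * sin (real n * \<phi>))" for n
  proof -
    define h A B c c' d d' where "h = theta4_dlog_coeff s (int n)" and "A = complex_of_real (a ^ n)"
      and "B = complex_of_real (inverse a ^ n)" and "c = cis (real n * \<theta>)" and "c' = cis (-(real n * \<theta>))"
      and "d = cis (real n * \<phi>)" and "d' = cis (-(real n * \<phi>))"
    note defs = this
    have f: "f (int n) = h * ((A * c * d - B * c * d) - (A * c * d' - B * c * d'))"
         "f (- int n) = (- h) * ((B * c' * d' - A * c' * d') - (B * c' * d - A * c' * d))"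
      unfolding f_def E
      by (simp_all only: theta4_dlog_coeff_minus defs of_int_of_nat_eq of_int_minus
            mult_minus_left mult_minus_right minus_minus exp_ln)
    have "f (int n) + f (- int n) = h * (A - B) * (c - c') * (d - d')"
      unfolding f by (simp add: algebra_simps)
    also have "c - c' = 2 * \<i> * of_real (cheb_sin n \<theta> * sin \<theta>)"
      unfolding defs cis_diff cheb_sin_mult_sin ..
    also have "d - d' = 2 * \<i> * of_real (sin (real n * \<phi>))"
      unfolding defs cis_diff ..
    also have "h * (A - B) = 2 * \<i> * of_real (AW_mult s a n)"
    proof -
      have "h * (A - B) = (- 2 * \<i> * (A - B)) / of_real (inverse s ^ n - s ^ n)"
        by (simp add: h_def theta4_dlog_coeff_def power_int_minus power_inverse)
      also have "- 2 * \<i> * (A - B) = 2 * \<i> * of_real (inverse a ^ n - a ^ n)"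
        by (simp add: A_def B_def algebra_simps)
      finally show ?thesis by (simp add: AW_mult_def)
    qed
    finally show ?thesis
      by (simp add: algebra_simps)
  qed
  with sums have "(\<lambda>n. - 8 * \<i> * of_real (sin \<theta>) * of_real (AW_mult s a n * cheb_sin n \<theta> * sin (real n * \<phi>))) sums
      (L (k (- ln a) \<phi>) - L (k (ln a) \<phi>) - (L (k (- ln a) (-\<phi>)) - L (k (ln a) (-\<phi>))))"
    by simp
  moreover have "(\<lambda>n. - 8 * \<i> * of_real (sin \<theta>) * of_real (AW_mult s a n * cheb_sin n \<theta> * sin (real n * \<phi>))) sums
      (- 8 * \<i> * of_real (sin \<theta>) * of_real (sine_kernel (AW_mult s a) \<theta> \<phi>))"
    by (intro sums_mult sums_of_real sine_kernel_sums summable_AW_mult s)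
  ultimately show ?thesis
    using sums_unique2 by fastforce
qed

lemma absolutely_integrable_continuous_mult:
  fixes k G :: "real \<Rightarrow> complex"
  assumes "continuous_on {a..b} k" "G absolutely_integrable_on {a..b}"
  shows "(\<lambda>x. k x * G x) absolutely_integrable_on {a..b}"
proof (rule absolutely_integrable_bounded_measurable_product[where h = "(*)" and f = k and g = G])
  show "bilinear ((*) :: complex \<Rightarrow> _)"
    by (simp add: bilinear_conv_bounded_bilinear bounded_bilinear_mult)
  show "k \<in> borel_measurable (lebesgue_on {a..b})"
    by (rule continuous_imp_measurable_on_sets_lebesgue[OF assms(1)]) simp
  show "bounded (k ` {a..b})"
    by (rule compact_imp_bounded[OF compact_continuous_image[OF assms(1)]]) simp
qed (simp_all add: assms)

lemma continuous_on_theta4_log_derivative: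
  assumes s: "0 < s" "s < 1" and w: "\<bar>Im w\<bar> < - ln s"
  shows "continuous_on A (\<lambda>t. theta4' ((w + of_real t) / 2) (of_real s) / theta4 ((w + of_real t) / 2) (of_real s))"
proof -
  have hol: "(\<lambda>z. theta4 z (of_real s)) holomorphic_on UNIV"
    using theta4_holomorphic[of "of_real s"] s by simp
  hence "(\<lambda>z. theta4' z (of_real s)) holomorphic_on UNIV"
    unfolding theta4'_def by (rule holomorphic_deriv) simp
  hence cont: "continuous_on UNIV (\<lambda>z. theta4' z (of_real s))" "continuous_on UNIV (\<lambda>z. theta4 z (of_real s))"
    using hol holomorphic_on_imp_continuous_on by blast+
  have "theta4 ((w + of_real t) / 2) (of_real s) \<noteq> 0" for t :: real
    by (rule theta4_nonzero[OF s]) (use w in simp)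
  moreover have "continuous_on A (\<lambda>t. (w + of_real t) / 2)"
    by (intro continuous_intros) auto
  ultimately show ?thesis
    using continuous_on_compose2[OF cont(1)] continuous_on_compose2[OF cont(2)]
    by (intro continuous_on_divide) auto
qed

text \<open>Since g (cos \<phi>) sin \<phi> is odd in \<phi>, adding the integrands at \<phi> and -
  \<phi> leaves only the antisymmetric part of the kernel, which
  \<open>theta4_log_derivative_difference\<close> evaluates. The factor (1/s - s) / (1/a - a) is the
  one that tends to 1.\<close>

lemma AW_quotient_integral:
  fixes g :: "real \<Rightarrow> complex"
  assumes q: "0 < q" "q < p" "p < 1"
    and g: "(\<lambda>\<phi>. g (cos \<phi>)) absolutely_integrable_on {-pi..pi}"
    and \<theta>: "sin \<theta> \<noteq> 0"
  defines "s \<equiv> sqrt q" and "a \<equiv> sqrt p"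
  shows "AW_quotient p (AW_inv q g) \<theta> = of_real ((1 / s - s) / (1 / a - a) / pi) *
           integral {-pi..pi} (\<lambda>\<phi>. of_real (sine_kernel (AW_mult s a) \<theta> \<phi> * sin \<phi>) * g (cos \<phi>))"
proof -
  have s: "0 < s" "s < a" "a < 1"
    using q by (auto simp: s_def a_def)
  hence s1: "s < 1" by simp
  define L where "L z = theta4' z (of_real s) / theta4 z (of_real s)" for z
  define w where "w y = of_real \<theta> + \<i> * complex_of_real y" for y
  define k where "k y t = L ((w y + of_real t) / 2)" for y and t :: real
  define I where "I y = integral {-pi..pi} (\<lambda>t. k y t * (g (cos t) * of_real (sin t)))" for y
  define K where "K = (1 / s - s) / (4 * pi)"
  have ln: "ln a < 0" "ln s < ln a"
    using s by auto
  have g_sin: "(\<lambda>t. of_real (sin t) * g (cos t)) absolutely_integrable_on {-pi..pi}"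
    by (rule absolutely_integrable_continuous_mult[OF _ g]) (intro continuous_intros)
  have int: "(\<lambda>t. k y t * (g (cos t) * of_real (sin t))) integrable_on {-pi..pi}" if "\<bar>y\<bar> < - ln s" for y
    using absolutely_integrable_continuous_mult[OF continuous_on_theta4_log_derivative[OF s(1) s1, of "w y"] g_sin] that
    by (simp add: k_def L_def w_def mult.commute[of "g _"] absolutely_integrable_on_def)
  have AW_inv: "AW_inv q g (cos (w y)) = of_real K * I y" for y
  proof -
    have "(1 - q) / (4 * pi * sqrt q) = K"
      using q by (simp add: K_def s_def field_simps)
    thus ?thesis
      using q by (simp add: AW_inv_cos AW_inv_trig_def I_def k_def L_def s_def mult_ac)
  qed
  \<comment> \<open>The point e^(-y) e^(i\<theta>) is exp (i w) for the complex angle w = \<theta> +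
    i y, so the trigonometric form of the operator can be evaluated at w.\<close>
  have breve: "breve (AW_inv q g) (of_real (exp (- y)) * exp (\<i> * of_real \<theta>)) = of_real K * I y" for y
  proof -
    have "of_real (exp (- y)) * exp (\<i> * of_real \<theta>) = exp (\<i> * w y)"
      by (simp add: w_def exp_of_real[symmetric] algebra_simps flip: exp_add)
    thus ?thesis by (simp only: breve_exp AW_inv)
  qed
  have p: "p powr (1/2) = exp (- (- ln a))" "p powr (-1/2) = exp (- ln a)"
    using q by (simp_all add: a_def powr_def ln_sqrt)
  have exp_ln: "exp (- (- ln a)) = a" "exp (- ln a) = 1 / a"
    using s by (simp_all add: exp_minus field_simps)
  define D where "D t = (k (- ln a) t - k (ln a) t) * (g (cos t) * of_real (sin t))" for t
  have D: "D integrable_on {-pi..pi}" "integral {-pi..pi} D = I (- ln a) - I (ln a)"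
    using integrable_diff[OF int int, of "- ln a" "ln a"] integral_diff[OF int int, of "- ln a" "ln a"] ln
    by (simp_all add: D_def[abs_def] I_def left_diff_distrib)
  have "(\<lambda>t. D (- t)) integrable_on {-pi..- (-pi)}"
    using D(1) by (subst Henstock_Kurzweil_Integration.integrable_reflect_real)
  hence "integral {-pi..pi} (\<lambda>t. D t + D (- t)) = integral {-pi..pi} D + integral {-pi..- (-pi)} (\<lambda>t. D (- t))"
    using integral_add[OF D(1), of "\<lambda>t. D (- t)"] by simp
  also have "integral {-pi..- (-pi)} (\<lambda>t. D (- t)) = integral {-pi..pi} D"
    by (rule Henstock_Kurzweil_Integration.integral_reflect_real)
  finally have "2 * (I (- ln a) - I (ln a)) = integral {-pi..pi} (\<lambda>t. D t + D (- t))"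
    using D(2) by simp
  also have "(\<lambda>t. D t + D (- t)) = (\<lambda>t. - 8 * \<i> * of_real (sin \<theta>) *
               (of_real (sine_kernel (AW_mult s a) \<theta> t * sin t) * g (cos t)))"
  proof
    fix t
    have "D t + D (- t) = (k (- ln a) t - k (ln a) t - (k (- ln a) (- t) - k (ln a) (- t))) *
            (g (cos t) * of_real (sin t))"
      by (simp add: D_def algebra_simps)
    also have "\<dots> = - 8 * \<i> * of_real (sin \<theta> * sine_kernel (AW_mult s a) \<theta> t) * (g (cos t) * of_real (sin t))"
      unfolding k_def L_def w_def theta4_log_derivative_difference[OF s] ..
    finally show "D t + D (- t) = - 8 * \<i> * of_real (sin \<theta>) *
               (of_real (sine_kernel (AW_mult s a) \<theta> t * sin t) * g (cos t))"
      by simp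
  qed
  finally have two_I: "2 * (I (- ln a) - I (ln a)) = - 8 * \<i> * of_real (sin \<theta>) *
      integral {-pi..pi} (\<lambda>t. of_real (sine_kernel (AW_mult s a) \<theta> t * sin t) * g (cos t))"
    by simp
  have "I (- ln a) - I (ln a) = 2 * (I (- ln a) - I (ln a)) / 2"
    by simp
  also note two_I
  finally have I_diff: "I (- ln a) - I (ln a) = - 4 * \<i> * of_real (sin \<theta>) *
      integral {-pi..pi} (\<lambda>t. of_real (sine_kernel (AW_mult s a) \<theta> t * sin t) * g (cos t))"
    by simp
  have a1: "1 / a - a \<noteq> 0"
    using s by (simp add: field_simps power2_eq_square[symmetric] power2_eq_1_iff)
  have "AW_quotient p (AW_inv q g) \<theta> =
          of_real K * (I (- ln a) - I (ln a)) / (\<i> * of_real (a - 1 / a) * of_real (sin \<theta>))"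
    unfolding AW_quotient_def p exp_ln breve[of "- ln a", unfolded exp_ln] breve[of "ln a", unfolded exp_ln]
    by (simp only: right_diff_distrib)
  also have "\<dots> = of_real (4 * K / (1 / a - a)) *
      integral {-pi..pi} (\<lambda>t. of_real (sine_kernel (AW_mult s a) \<theta> t * sin t) * g (cos t))" (is "_ = _ * ?J")
  proof -
    have "complex_of_real (a - 1 / a) = - of_real (1 / a - a)"
      by simp
    moreover have "complex_of_real (1 / a - a) \<noteq> 0"
      using a1 by (simp only: of_real_eq_0_iff not_False_eq_True)
    ultimately show ?thesis
      unfolding I_diff of_real_divide[of "4 * K"] using \<theta>
      by (simp add: divide_simps del: of_real_diff of_real_divide)
  qed
  also have "4 * K / (1 / a - a) = (1 / s - s) / (1 / a - a) / pi"
  proof -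
    have "4 * (X / (4 * pi)) / Y = X / Y / pi" for X Y
      by (simp add: mult.commute)
    thus ?thesis unfolding K_def .
  qed
  finally show ?thesis .
qed

text \<open>Dominated convergence. It serves the endpoints x = 1 and x = -1, where
  \<open>AW_op\<close> is a limit in \<theta>.\<close>

lemma continuous_integral_sine_kernel:
  fixes G :: "real \<Rightarrow> complex"
  assumes c: "summable (\<lambda>n. \<bar>c n\<bar> * real n)" and G: "G absolutely_integrable_on {-pi..pi}"
  shows "isCont (\<lambda>\<theta>. integral {-pi..pi} (\<lambda>\<phi>. of_real (sine_kernel c \<theta> \<phi> * sin \<phi>) * G \<phi>)) \<theta>"
proof (rule continuous_at_sequentiallyI)
  fix X :: "nat \<Rightarrow> real"
  assume X: "X \<longlonglongrightarrow> \<theta>"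
  let ?f = "\<lambda>\<theta> \<phi>. complex_of_real (sine_kernel c \<theta> \<phi> * sin \<phi>) * G \<phi>"
  let ?M = "\<Sum>n. \<bar>c n\<bar> * real n"
  show "(\<lambda>k. integral {-pi..pi} (?f (X k))) \<longlonglongrightarrow> integral {-pi..pi} (?f \<theta>)"
  proof (rule dominated_convergence)
    show "?f (X k) integrable_on {-pi..pi}" for k
      by (rule set_lebesgue_integral_eq_integral(1), rule absolutely_integrable_continuous_mult[OF _ G])
         (intro continuous_intros c)
    show "(\<lambda>\<phi>. ?M * norm (G \<phi>)) integrable_on {-pi..pi}"
      using G by (intro integrable_on_mult_right) (simp add: absolutely_integrable_on_def)
    fix \<phi>
    show "norm (?f (X k) \<phi>) \<le> ?M * norm (G \<phi>)" for k
    proof -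
      have "\<bar>sine_kernel c (X k) \<phi>\<bar> * \<bar>sin \<phi>\<bar> \<le> ?M * 1"
        using abs_sine_kernel_le[OF c] by (intro mult_mono) (auto intro: order_trans[OF abs_ge_zero])
      thus ?thesis by (simp add: norm_mult mult_right_mono)
    qed
    have "isCont (\<lambda>\<theta>. sine_kernel c \<theta> \<phi>) \<theta>"
      using continuous_on_sine_kernel[OF c, of UNIV "\<lambda>\<theta>. \<theta>" "\<lambda>_. \<phi>"]
      by (simp add: continuous_on_eq_continuous_at)
    hence "(\<lambda>k. sine_kernel c (X k) \<phi>) \<longlonglongrightarrow> sine_kernel c \<theta> \<phi>"
      using X isCont_tendsto_compose by blast
    thus "(\<lambda>k. ?f (X k) \<phi>) \<longlonglongrightarrow> ?f \<theta> \<phi>"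
      by (intro tendsto_intros)
  qed
qed

lemma eventually_sin_nonzero: "\<forall>\<^sub>F t in at \<theta>. sin t \<noteq> 0" if "sin \<theta> = 0" for \<theta> :: real
proof -
  have "t = \<theta>" if t: "sin t = 0" "dist t \<theta> < pi" for t
  proof -
    obtain i j where ij: "\<theta> = of_int i * pi" "t = of_int j * pi"
      using \<open>sin \<theta> = 0\<close> t(1) by (auto simp: sin_zero_iff_int2)
    have "dist t \<theta> = of_int \<bar>j - i\<bar> * pi"
      unfolding ij dist_real_def left_diff_distrib[symmetric] abs_mult by simp
    with t(2) have "of_int \<bar>j - i\<bar> * pi < of_int 1 * pi" by simp
    hence "real_of_int \<bar>j - i\<bar> < of_int 1"
      using pi_gt_zero mult_less_cancel_right_pos by blast
    hence "\<bar>j - i\<bar> < 1" by linarith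
    thus ?thesis by (simp add: ij)
  qed
  thus ?thesis
    unfolding eventually_at using pi_gt_zero by blast
qed

text \<open>At an endpoint the quotient agrees with the integral expression in a punctured
  neighbourhood of arccos x, and that expression is continuous in \<theta> because
  \<open>cheb_sin\<close> has no singularity. Its value there is thus the limit.\<close>

lemma AW_op_integral:
  fixes g :: "real \<Rightarrow> complex"
  assumes q: "0 < q" "q < p" "p < 1"
    and g: "(\<lambda>\<phi>. g (cos \<phi>)) absolutely_integrable_on {-pi..pi}"
  defines "s \<equiv> sqrt q" and "a \<equiv> sqrt p"
  shows "AW_op p (AW_inv q g) x = of_real ((1 / s - s) / (1 / a - a) / pi) *
           integral {-pi..pi} (\<lambda>\<phi>. of_real (sine_kernel (AW_mult s a) (arccos x) \<phi> * sin \<phi>) * g (cos \<phi>))"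
proof (cases "sin (arccos x) = 0")
  case True
  have s: "0 < s" "s < a" "a < 1"
    using q by (auto simp: s_def a_def)
  let ?M = "\<lambda>\<theta>. of_real ((1 / s - s) / (1 / a - a) / pi) *
         integral {-pi..pi} (\<lambda>\<phi>. of_real (sine_kernel (AW_mult s a) \<theta> \<phi> * sin \<phi>) * g (cos \<phi>))"
  have "isCont ?M (arccos x)"
    by (intro continuous_intros continuous_integral_sine_kernel summable_AW_mult s g)
  hence "(?M \<longlongrightarrow> ?M (arccos x)) (at (arccos x))"
    by (simp add: isCont_def)
  moreover have "\<forall>\<^sub>F \<theta> in at (arccos x). ?M \<theta> = AW_quotient p (AW_inv q g) \<theta>"
    using eventually_sin_nonzero[OF True]
    by eventually_elim (simp add: AW_quotient_integral[OF q g] s_def a_def)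
  ultimately have "(AW_quotient p (AW_inv q g) \<longlongrightarrow> ?M (arccos x)) (at (arccos x))"
    by (rule Lim_transform_eventually)
  thus ?thesis
    using True by (simp add: AW_op_def tendsto_Lim)
next
  case False
  thus ?thesis
    by (simp add: AW_op_def AW_quotient_integral[OF q g] s_def a_def)
qed

section \<open>Passage to the limit\<close>

text \<open>The error terms are, in order: the deviation of G from c where cos \<phi> is near cos
  \<theta>, the replacement of the multipliers by powers of s / a, the Poisson kernel away from cos
  \<theta>, and its missing mass pi (1 - s / a). With b, B and \<delta> fixed, all but the first
  tend to 0 as a tends to s.\<close>

lemma sine_kernel_integral_estimate:
  fixes G :: "real \<Rightarrow> complex" and c :: complex
  assumes s: "0 < s" "s < a" "a\<^sup>2 \<le> b" "b < 1"
    and G: "G absolutely_integrable_on {-pi..pi}" "\<And>\<phi>. norm (G \<phi>) \<le> B" "norm c \<le> B"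
    and \<delta>: "0 < \<delta>" "s / a + 1 / (s / a) - 2 \<le> \<delta>"
    and e: "\<And>\<phi>. \<bar>cos \<phi> - cos \<theta>\<bar> < \<delta> \<Longrightarrow> norm (G \<phi> - c) \<le> e"
  shows "norm (integral {-pi..pi} (\<lambda>\<phi>. of_real (sine_kernel (AW_mult s a) \<theta> \<phi> * sin \<phi>) * G \<phi>) - pi * c) \<le>
           pi * e +
           (2 * pi * B * ((a\<^sup>2 - s\<^sup>2) * ((\<Sum>n. real n * (real n * b ^ (n - 1))) / (1 - s\<^sup>2))) +
            4 * pi * B * ((1 - (s / a)\<^sup>2) / (s / a * \<delta>\<^sup>2)) + pi * B * (1 - s / a))"
proof -
  define r where "r = s / a"
  define V where "V \<phi> = sine_kernel (\<lambda>n. r ^ n) \<theta> \<phi> * sin \<phi>" for \<phi>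
  define W where "W \<phi> = sine_kernel (AW_mult s a) \<theta> \<phi> * sin \<phi>" for \<phi>
  define E where "E = (a\<^sup>2 - s\<^sup>2) * ((\<Sum>n. real n * (real n * b ^ (n - 1))) / (1 - s\<^sup>2))"
  define M where "M = (1 - r\<^sup>2) / (r * \<delta>\<^sup>2)"
  have "a\<^sup>2 < 1" using s by simp
  hence a: "a < 1" using s by (simp add: power_less_one_iff)
  have r: "0 < r" "r < 1" using s by (auto simp: r_def)
  have B: "0 \<le> B" using G(3) norm_ge_zero order_trans by blast
  have Gc: "norm (G \<phi> - c) \<le> 2 * B" for \<phi>
    using G(2)[of \<phi>] G(3) norm_triangle_ineq4[of "G \<phi>" c] by linarith
  have e0: "0 \<le> e"
    using e[of \<theta>] \<delta> norm_ge_zero[of "G \<theta> - c"] by (simp add: order_trans[OF norm_ge_zero])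
  have M0: "0 \<le> M"
    using r power_le_one[of r 2] by (simp add: M_def)
  have summV: "summable (\<lambda>n. \<bar>r ^ n\<bar> * real n)"
    using r by (intro summable_power_mult_of_nat) auto
  have contV: "continuous_on A (\<lambda>\<phi>. complex_of_real (V \<phi>))" for A
    unfolding V_def by (intro continuous_intros summV)
  have contW: "continuous_on A (\<lambda>\<phi>. complex_of_real (W \<phi>))" for A
    unfolding W_def by (intro continuous_intros summable_AW_mult s a)
  have Gc_int: "(\<lambda>\<phi>. G \<phi> - c) absolutely_integrable_on {-pi..pi}"
    by (intro set_integral_diff G) (auto intro!: absolutely_integrable_continuous_real continuous_intros)
  have VG: "(\<lambda>\<phi>. of_real (V \<phi>) * (G \<phi> - c)) integrable_on {-pi..pi}"
    by (rule set_lebesgue_integral_eq_integral(1), rule absolutely_integrable_continuous_mult[OF contV Gc_int])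
  have WG: "(\<lambda>\<phi>. (of_real (W \<phi>) - of_real (V \<phi>)) * G \<phi>) integrable_on {-pi..pi}"
    by (rule set_lebesgue_integral_eq_integral(1), rule absolutely_integrable_continuous_mult[OF continuous_on_diff[OF contW contV] G(1)])
  have V: "(V has_integral pi * r) {-pi..pi}"
    using has_integral_sine_kernel_sin[OF summV, of \<theta>] by (simp add: V_def[abs_def])
  hence Vc: "((\<lambda>\<phi>. of_real (V \<phi>) * c) has_integral of_real (pi * r) * c) {-pi..pi}"
    by (intro has_integral_mult_left has_integral_of_real)
  have "(\<lambda>\<phi>. of_real (W \<phi>) * G \<phi>) =
          (\<lambda>\<phi>. (of_real (W \<phi>) - of_real (V \<phi>)) * G \<phi> + (of_real (V \<phi>) * (G \<phi> - c) + of_real (V \<phi>) * c))"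
    by (auto simp: algebra_simps)
  hence "integral {-pi..pi} (\<lambda>\<phi>. of_real (W \<phi>) * G \<phi>) =
          integral {-pi..pi} (\<lambda>\<phi>. (of_real (W \<phi>) - of_real (V \<phi>)) * G \<phi>) +
          (integral {-pi..pi} (\<lambda>\<phi>. of_real (V \<phi>) * (G \<phi> - c)) + of_real (pi * r) * c)"
    using Vc WG VG by (simp only: integral_add integrable_add has_integral_integrable integral_unique)
  hence eq: "integral {-pi..pi} (\<lambda>\<phi>. of_real (W \<phi>) * G \<phi>) - pi * c =
          integral {-pi..pi} (\<lambda>\<phi>. (of_real (W \<phi>) - of_real (V \<phi>)) * G \<phi>) +
          integral {-pi..pi} (\<lambda>\<phi>. of_real (V \<phi>) * (G \<phi> - c)) + of_real (- pi * (1 - r)) * c"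
    by (simp add: algebra_simps)
  have "norm (integral {-pi..pi} (\<lambda>\<phi>. (of_real (W \<phi>) - of_real (V \<phi>)) * G \<phi>)) \<le> integral {-pi..pi} (\<lambda>_. E * B)"
  proof (rule Henstock_Kurzweil_Integration.integral_norm_bound_integral[OF WG])
    fix \<phi>
    have "\<bar>W \<phi> - V \<phi>\<bar> = \<bar>sine_kernel (\<lambda>n. r ^ n) \<theta> \<phi> - sine_kernel (AW_mult s a) \<theta> \<phi>\<bar> * \<bar>sin \<phi>\<bar>"
      unfolding W_def V_def left_diff_distrib[symmetric] abs_mult by (simp add: abs_minus_commute)
    also have "\<dots> \<le> E * 1"
      using sine_kernel_AW_mult_approx[OF s, of \<theta> \<phi>]
      by (intro mult_mono) (auto simp: E_def r_def intro: order_trans[OF abs_ge_zero])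
    finally have "\<bar>W \<phi> - V \<phi>\<bar> * norm (G \<phi>) \<le> E * B"
      using G(2)[of \<phi>] by (intro mult_mono) (auto intro: order_trans[OF abs_ge_zero])
    thus "norm ((of_real (W \<phi>) - of_real (V \<phi>)) * G \<phi>) \<le> E * B"
      by (simp add: norm_mult flip: of_real_diff)
  qed (rule integrable_const_ivl)
  hence 1: "norm (integral {-pi..pi} (\<lambda>\<phi>. (of_real (W \<phi>) - of_real (V \<phi>)) * G \<phi>)) \<le> 2 * pi * B * E"
    by (simp add: mult_ac)
  \<comment> \<open>One majorant for both cases: the first summand serves near cos \<theta>, the
    second away from it. Keeping V in the first summand lets its mass pi r enter instead of a
    pointwise bound, which would blow up.\<close>
  have bound: "((\<lambda>\<phi>. V \<phi> * e + 2 * B * M) has_integral (pi * r * e + 2 * B * M * (2 * pi))) {-pi..pi}"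
    using has_integral_const_real[of "2 * B * M" "-pi" pi]
    by (intro has_integral_add has_integral_mult_left V) (simp add: mult_ac)
  have "norm (integral {-pi..pi} (\<lambda>\<phi>. of_real (V \<phi>) * (G \<phi> - c))) \<le> integral {-pi..pi} (\<lambda>\<phi>. V \<phi> * e + 2 * B * M)"
  proof (rule Henstock_Kurzweil_Integration.integral_norm_bound_integral[OF VG])
    show "(\<lambda>\<phi>. V \<phi> * e + 2 * B * M) integrable_on {-pi..pi}"
      using bound by blast
    fix \<phi>
    have V0: "0 \<le> V \<phi>"
      unfolding V_def by (rule sine_kernel_power_nonneg[OF r])
    have "V \<phi> * norm (G \<phi> - c) \<le> V \<phi> * e + 2 * B * M"
    proof (cases "\<bar>cos \<phi> - cos \<theta>\<bar> < \<delta>")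
      case True
      hence "V \<phi> * norm (G \<phi> - c) \<le> V \<phi> * e"
        by (intro mult_left_mono e V0)
      moreover have "0 \<le> 2 * B * M" using B M0 by simp
      ultimately show ?thesis by linarith
    next
      case False
      hence "V \<phi> \<le> M"
        unfolding V_def M_def using \<delta> r by (intro sine_kernel_power_bound) (auto simp: r_def)
      hence "V \<phi> * norm (G \<phi> - c) \<le> M * (2 * B)"
        using M0 Gc by (intro mult_mono) auto
      moreover have "0 \<le> V \<phi> * e" using V0 e0 by simp
      ultimately show ?thesis by (simp add: mult_ac)
    qed
    thus "norm (of_real (V \<phi>) * (G \<phi> - c)) \<le> V \<phi> * e + 2 * B * M"
      using V0 by (simp add: norm_mult)
  qed
  also have "\<dots> = pi * r * e + 2 * B * M * (2 * pi)"
    by (rule integral_unique[OF bound])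
  also have "pi * r * e \<le> pi * 1 * e"
    using r e0 by (intro mult_mono mult_right_mono) auto
  finally have 2: "norm (integral {-pi..pi} (\<lambda>\<phi>. of_real (V \<phi>) * (G \<phi> - c))) \<le> pi * e + 4 * pi * B * M"
    by (simp add: mult_ac)
  have "norm (of_real (- pi * (1 - r)) * c) = pi * (1 - r) * norm c"
    using r unfolding norm_mult norm_of_real abs_mult by simp
  also have "\<dots> \<le> pi * (1 - r) * B"
    using r G(3) by (intro mult_left_mono) auto
  finally have 3: "norm (of_real (- pi * (1 - r)) * c) \<le> pi * B * (1 - r)"
    by (simp add: mult_ac)
  have "norm (integral {-pi..pi} (\<lambda>\<phi>. of_real (W \<phi>) * G \<phi>) - pi * c) \<le>
          2 * pi * B * E + (pi * e + 4 * pi * B * M) + pi * B * (1 - r)"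
    unfolding eq by (intro norm_triangle_mono 1 2 3)
  thus ?thesis
    by (simp add: W_def E_def M_def r_def algebra_simps)
qed

section \<open>Boundedness and integrability of functions with finitely many jumps\<close>

text \<open>Finite one-sided limits l and r at x keep the nearby values within 1 of l, within 1 of
  r, or equal to g x. The bisection principle \<open>Bolzano\<close> makes this local boundedness
  global, as boundedness passes to unions of adjacent intervals.\<close>

lemma continuous_except_jumps_bounded:
  assumes "continuous_except_jumps g"
  shows "bounded (g ` {-1..1})"
proof -
  have "bounded (g ` ({-1..1} \<inter> {-1..1}))"
  proof (rule Bolzano[where P = "\<lambda>a b. bounded (g ` ({a..b} \<inter> {-1..1}))"])
    fix a b c :: real
    assume "bounded (g ` ({a..b} \<inter> {-1..1}))" "bounded (g ` ({b..c} \<inter> {-1..1}))" "a \<le> b" "b \<le> c"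
    moreover from this have "{a..c} = {a..b} \<union> {b..c}" by auto
    ultimately show "bounded (g ` ({a..c} \<inter> {-1..1}))"
      by (simp add: Int_Un_distrib2 image_Un)
  next
    fix x :: real
    assume x: "-1 \<le> x" "x \<le> 1"
    have "\<exists>l r. (g \<longlongrightarrow> l) (at x within {-1..<x}) \<and> (g \<longlongrightarrow> r) (at x within {x<..1})"
    proof (cases "continuous (at x within {-1..1}) g")
      case True
      hence "(g \<longlongrightarrow> g x) (at x within {-1..1})"
        by (simp add: continuous_within)
      moreover have "{-1..<x} \<subseteq> {-1..1}" "{x<..1} \<subseteq> {-1..1}"
        using x by auto
      ultimately show ?thesis
        by (meson tendsto_within_subset)
    next
      case False
      thus ?thesis
        using assms x by (auto simp: continuous_except_jumps_def is_jump_def)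
    qed
    then obtain l r where lr: "(g \<longlongrightarrow> l) (at x within {-1..<x})" "(g \<longlongrightarrow> r) (at x within {x<..1})"
      by blast
    obtain d1 where d1: "d1 > 0" "\<And>y. y \<in> {-1..<x} \<Longrightarrow> y \<noteq> x \<Longrightarrow> dist y x < d1 \<Longrightarrow> dist (g y) l < 1"
      using tendstoD[OF lr(1), of 1] unfolding eventually_at by auto
    obtain d2 where d2: "d2 > 0" "\<And>y. y \<in> {x<..1} \<Longrightarrow> y \<noteq> x \<Longrightarrow> dist y x < d2 \<Longrightarrow> dist (g y) r < 1"
      using tendstoD[OF lr(2), of 1] unfolding eventually_at by auto
    have "bounded (g ` ({a..b} \<inter> {-1..1}))" if "a \<le> x" "x \<le> b" "b - a < min d1 d2" for a b
    proof (rule bounded_subset)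
      show "bounded (ball l 1 \<union> (ball r 1 \<union> {g x}))" by simp
      show "g ` ({a..b} \<inter> {-1..1}) \<subseteq> ball l 1 \<union> (ball r 1 \<union> {g x})"
      proof (clarsimp simp: dist_commute)
        fix y
        assume y: "a \<le> y" "y \<le> b" "-1 \<le> y" "y \<le> 1" "g y \<noteq> g x" "\<not> dist r (g y) < 1"
        have "dist y x < d1" "dist y x < d2"
          using y that by (auto simp: dist_real_def)
        thus "dist l (g y) < 1"
          using d1(2)[of y] d2(2)[of y] y by (cases y x rule: linorder_cases) (auto simp: dist_commute)
      qed
    qed
    thus "\<exists>d>0. \<forall>a b. a \<le> x \<and> x \<le> b \<and> b - a < d \<longrightarrow> bounded (g ` ({a..b} \<inter> {-1..1}))"
      using d1(1) d2(1) by (intro exI[of _ "min d1 d2"]) auto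
  qed simp
  thus ?thesis by simp
qed

text \<open>At most two points of [-pi, pi] share a cosine, so the composition is continuous off a
  finite, hence null, set. This gives measurability, and boundedness then gives
  integrability.\<close>

lemma continuous_except_jumps_absolutely_integrable_cos:
  assumes "continuous_except_jumps g"
  shows "(\<lambda>\<phi>. g (cos \<phi>)) absolutely_integrable_on {-pi..pi}"
proof -
  define D where "D = {x\<in>{-1..1}. \<not> continuous (at x within {-1..1}) g}"
  define N where "N = {\<phi>\<in>{-pi..pi}. cos \<phi> \<in> D}"
  have "finite D"
    using assms by (simp add: continuous_except_jumps_def D_def)
  have "\<phi> \<in> arccos ` D \<union> (\<lambda>x. - arccos x) ` D" if "\<phi> \<in> N" for \<phi>
  proof (cases "0 \<le> \<phi>")
    case True
    hence "\<phi> = arccos (cos \<phi>)"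
      using that by (simp add: N_def arccos_cos)
    thus ?thesis using that by (auto simp: N_def)
  next
    case False
    hence "\<phi> = - arccos (cos \<phi>)"
      using that arccos_cos[of "-\<phi>"] by (simp add: N_def)
    thus ?thesis using that by (auto simp: N_def)
  qed
  hence "finite N"
    using finite_subset[of N "arccos ` D \<union> (\<lambda>x. - arccos x) ` D"] \<open>finite D\<close> by blast
  have "continuous (at \<phi> within {-pi..pi} - N) (\<lambda>\<phi>. g (cos \<phi>))" if "\<phi> \<in> {-pi..pi} - N" for \<phi>
  proof (rule continuous_within_compose2[where g = g and f = cos])
    show "continuous (at (cos \<phi>) within cos ` ({-pi..pi} - N)) g"
      by (rule continuous_within_subset[of _ "{-1..1}"]) (use that in \<open>auto simp: N_def D_def\<close>)
  qed (intro continuous_intros)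
  hence "continuous_on ({-pi..pi} - N) (\<lambda>\<phi>. g (cos \<phi>))"
    by (simp add: continuous_on_eq_continuous_within)
  hence "(\<lambda>\<phi>. g (cos \<phi>)) \<in> borel_measurable (lebesgue_on ({-pi..pi} - N))"
    by (rule continuous_imp_measurable_on_sets_lebesgue)
       (use \<open>finite N\<close> in \<open>simp add: sets.Diff negligible_imp_sets negligible_finite\<close>)
  moreover have "N \<in> null_sets (lebesgue_on {-pi..pi})"
    using \<open>finite N\<close> negligible_finite[of N]
    by (subst null_sets_restrict_space) (auto simp: negligible_iff_null_sets N_def)
  ultimately have meas: "(\<lambda>\<phi>. g (cos \<phi>)) \<in> borel_measurable (lebesgue_on {-pi..pi})"
    by (subst (asm) borel_measurable_diff_null) auto
  obtain B where B: "\<And>x. x \<in> {-1..1} \<Longrightarrow> norm (g x) \<le> B"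
    using continuous_except_jumps_bounded[OF assms] by (metis (no_types, lifting) bounded_iff imageI)
  show ?thesis
    by (rule measurable_bounded_by_integrable_imp_absolutely_integrable[OF meas _ integrable_const_ivl[of B]])
       (use B in auto)
qed

theorem theorem2p2:
  fixes q x :: real and g :: "real \<Rightarrow> complex"
  assumes "0 < q" and "q < 1"
    and "continuous_except_jumps g"
    and "x \<in> {-1..1}" and "continuous (at x within {-1..1}) g"
  shows "((\<lambda>p. AW_op p (AW_inv q g) x) \<longlongrightarrow> g x) (at_right q)"
proof -
  define s where "s = sqrt q"
  \<comment> \<open>Any number strictly between q and 1 would do: p stays below it near q, which
    makes the error bound uniform in p.\<close>
  define b where "b = (1 + q) / 2"
  define G where "G \<phi> = g (cos \<phi>)" for \<phi>
  define J where "J p = integral {-pi..pi} (\<lambda>\<phi>. of_real (sine_kernel (AW_mult s (sqrt p)) (arccos x) \<phi> * sin \<phi>) * G \<phi>)" for p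
  have s: "0 < s" "s < 1" "q = s\<^sup>2"
    using assms(1,2) by (auto simp: s_def)
  have b: "q < b" "b < 1"
    using assms(2) by (auto simp: b_def)
  have cos_arccos_x: "cos (arccos x) = x"
    using assms(4) by simp
  have G: "G absolutely_integrable_on {-pi..pi}"
    using continuous_except_jumps_absolutely_integrable_cos[OF assms(3)] by (simp add: G_def[abs_def])
  obtain B where B: "\<And>x. x \<in> {-1..1} \<Longrightarrow> norm (g x) \<le> B"
    using continuous_except_jumps_bounded[OF assms(3)] by (metis (no_types, lifting) bounded_iff imageI)
  have near: "\<forall>\<^sub>F p in at_right q. q < p \<and> p < b"
    using b eventually_at_right[of q b] by auto
  have lim_sqrt: "((\<lambda>p. sqrt p) \<longlongrightarrow> s) (at_right q)"
    unfolding s_def by (intro tendsto_intros)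
  have lim_r: "((\<lambda>p. s / sqrt p) \<longlongrightarrow> 1) (at_right q)"
    using tendsto_divide[OF tendsto_const lim_sqrt, of s] s by simp
  have "(J \<longlongrightarrow> pi * g x) (at_right q)"
  proof (rule tendstoI)
    fix e :: real assume "e > 0"
    \<comment> \<open>The estimate will have the form pi e' + R p with R p < e' eventually.\<close>
    define e' where "e' = e / (pi + 1)"
    have "0 < pi + 1"
      using pi_gt_zero by linarith
    hence "e' > 0" "(pi + 1) * e' = e"
      using \<open>e > 0\<close> by (auto simp: e'_def)
    hence e': "e' > 0" "pi * e' + e' = e"
      by (auto simp: algebra_simps)
    obtain \<delta> where \<delta>: "\<delta> > 0" "\<And>y. y \<in> {-1..1} \<Longrightarrow> dist y x < \<delta> \<Longrightarrow> dist (g y) (g x) < e'"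
      using assms(5) e'(1) unfolding continuous_within_eps_delta by metis
    define R where "R p = 2 * pi * B * (((sqrt p)\<^sup>2 - s\<^sup>2) * ((\<Sum>n. real n * (real n * b ^ (n - 1))) / (1 - s\<^sup>2))) +
            4 * pi * B * ((1 - (s / sqrt p)\<^sup>2) / (s / sqrt p * \<delta>\<^sup>2)) + pi * B * (1 - s / sqrt p)" for p
    have "(R \<longlongrightarrow> 2 * pi * B * ((s\<^sup>2 - s\<^sup>2) * ((\<Sum>n. real n * (real n * b ^ (n - 1))) / (1 - s\<^sup>2))) +
            4 * pi * B * ((1 - 1\<^sup>2) / (1 * \<delta>\<^sup>2)) + pi * B * (1 - 1)) (at_right q)"
      unfolding R_def using \<delta>(1) by (intro tendsto_intros lim_sqrt lim_r) auto
    hence "\<forall>\<^sub>F p in at_right q. R p < e'"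
      using e'(1) by (intro order_tendstoD(2)) auto
    moreover have "((\<lambda>p. s / sqrt p + 1 / (s / sqrt p) - 2) \<longlongrightarrow> 1 + 1 / 1 - 2) (at_right q)"
      by (intro tendsto_intros lim_r) auto
    hence "\<forall>\<^sub>F p in at_right q. s / sqrt p + 1 / (s / sqrt p) - 2 < \<delta>"
      using \<delta>(1) by (intro order_tendstoD(2)) auto
    ultimately show "\<forall>\<^sub>F p in at_right q. dist (J p) (pi * g x) < e"
      using near
    proof eventually_elim
      case (elim p)
      have "norm (J p - pi * g x) \<le> pi * e' + R p"
        unfolding J_def R_def
      proof (rule sine_kernel_integral_estimate[OF s(1) _ _ b(2) G _ _ \<delta>(1)])
        show "s < sqrt p" "(sqrt p)\<^sup>2 \<le> b"
          using elim(3) assms(1) by (auto simp: s_def)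
        show "norm (G \<phi>) \<le> B" for \<phi>
          unfolding G_def by (rule B) simp
        show "norm (g x) \<le> B"
          using B assms(4) .
        show "s / sqrt p + 1 / (s / sqrt p) - 2 \<le> \<delta>"
          using elim(2) by simp
        show "norm (G \<phi> - g x) \<le> e'" if "\<bar>cos \<phi> - cos (arccos x)\<bar> < \<delta>" for \<phi>
          using \<delta>(2)[of "cos \<phi>"] that unfolding G_def cos_arccos_x by (simp add: dist_norm)
      qed
      with elim(1) e'(2) show ?case by (simp add: dist_norm)
    qed
  qed
  \<comment> \<open>The prefactor tends to 1 / pi, which cancels the factor pi in the limit of
    \<open>J\<close>.\<close>
  moreover have "((\<lambda>p. (1 / s - s) / (1 / sqrt p - sqrt p) / pi) \<longlongrightarrow> (1 / s - s) / (1 / s - s) / pi) (at_right q)"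
  proof (intro tendsto_intros lim_sqrt)
    show "1 / s - s \<noteq> 0"
      using s by (simp add: field_simps power2_eq_square[symmetric] power2_eq_1_iff)
  qed (use s in auto)
  moreover have "1 / s - s \<noteq> 0"
    using s by (simp add: field_simps power2_eq_square[symmetric] power2_eq_1_iff)
  ultimately have lim: "((\<lambda>p. of_real ((1 / s - s) / (1 / sqrt p - sqrt p) / pi) * J p) \<longlongrightarrow>
                       of_real (1 / pi) * (pi * g x)) (at_right q)"
    by (intro tendsto_mult tendsto_of_real) simp_all
  have "\<forall>\<^sub>F p in at_right q. of_real ((1 / s - s) / (1 / sqrt p - sqrt p) / pi) * J p = AW_op p (AW_inv q g) x"
    using near
  proof eventually_elim
    case (elim p)
    thus ?case
      using AW_op_integral[OF assms(1), of p g x] b G by (simp add: J_def G_def[abs_def] s_def)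
  qed
  from Lim_transform_eventually[OF lim this] show ?thesis
    by simp
qed

end
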